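(* Let $m\ge3$, let $U\subset\mathbb{R}^m$ be a (connected, open) domain, $\vec F$ a $C^1$ vector field on $U$, and $u,v$ real-valued $C^2$ functions on $U$ such that $\nabla u+\vec F\neq0$ and $\nabla v+\vec F\ne0$ everywhere in $U$. Suppose $H_{\vec F}(v)\le H_{\vec F}(u)$ and $v\ge u$ in $U$, and $v=u$ at a point $p_0\in U$. Assume that for $w=u$ (or, alternatively, for $w=v$) there exists in $U$ an orthonormal basis $N_1^\perp(w),\dots,N_{m-1}^\perp(w)$ (consisting of $C^\infty$ vector fields) of the space perpendicular to $N_{\vec F}(w)$, and that the rank of $\mathcal{L}(N_1^\perp(w),\dots,N_{m-1}^\perp(w))$ is constant $m$ in $U$. Then $v\equiv u$ in $U$.
   Context: $N_{\vec F}(u):=\frac{\nabla u+\vec F}{|\nabla u+\vec F|}$ and $H_{\vec F}(u):=\operatorname{div}N_{\vec F}(u)$ at points where $\nabla u+\vec F\ne0$ (Euclidean gradient, norm and divergence on $\mathbb{R}^m$); similarly for $v$. For $C^\infty$ vector fields $X_1,\dots,X_r$, $\mathcal{L}(X_1,\dots,X_r)$ is the smallest $C^\infty$-module of vector fields containing $X_1,\dots,X_r$ and closed under the Lie bracket; its rank at $q$ is the dimension of the span of $\{Z(q):Z\in\mathcal{L}(X_1,\dots,X_r)\}$. *)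

theory Defs
  imports "HOL-Analysis.Analysis"
begin

text \<open>All differential notions below are used on open sets only. Vector fields on an open set \<open>U\<close> are
  total functions whose values outside \<open>U\<close> are irrelevant.\<close>

text \<open>On an open subset of a finite-dimensional space, \<open>C\<^sup>k\<close> amounts to being differentiable with
  every directional derivative of class \<open>C\<^sup>k\<^sup>-\<^sup>1\<close>.\<close>

primrec Ck_on :: "nat \<Rightarrow> ('a::euclidean_space \<Rightarrow> 'b::real_normed_vector) \<Rightarrow> 'a set \<Rightarrow> bool" where
  "Ck_on 0 f U \<longleftrightarrow> continuous_on U f"
| "Ck_on (Suc k) f U \<longleftrightarrow>
     (\<forall>x\<in>U. f differentiable (at x)) \<and> (\<forall>h. Ck_on k (\<lambda>x. frechet_derivative f (at x) h) U)"

definition smooth_on :: "('a::euclidean_space \<Rightarrow> 'b::real_normed_vector) \<Rightarrow> 'a set \<Rightarrow> bool" where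
  "smooth_on f U \<longleftrightarrow> (\<forall>k. Ck_on k f U)"

definition grad :: "(real^'n \<Rightarrow> real) \<Rightarrow> real^'n \<Rightarrow> real^'n" where
  "grad f x = (\<chi> i. frechet_derivative f (at x) (axis i 1))"

lemma grad_eq: "GDERIV f x :> D \<Longrightarrow> grad f x = D"
  unfolding gderiv_def grad_def
  by (drule frechet_derivative_at[symmetric]) (simp add: vec_eq_iff inner_axis')

definition divergence :: "(real^'n \<Rightarrow> real^'n) \<Rightarrow> real^'n \<Rightarrow> real" where
  "divergence X x = trace (jacobian X (at x))"

definition normal_field :: "(real^'n \<Rightarrow> real^'n) \<Rightarrow> (real^'n \<Rightarrow> real) \<Rightarrow> real^'n \<Rightarrow> real^'n" where
  "normal_field F u x = (grad u x + F x) /\<^sub>R norm (grad u x + F x)"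

definition mean_curv :: "(real^'n \<Rightarrow> real^'n) \<Rightarrow> (real^'n \<Rightarrow> real) \<Rightarrow> real^'n \<Rightarrow> real" where
  "mean_curv F u x = divergence (normal_field F u) x"

definition lie_bracket :: "('a::euclidean_space \<Rightarrow> 'a) \<Rightarrow> ('a \<Rightarrow> 'a) \<Rightarrow> 'a \<Rightarrow> 'a" where
  "lie_bracket X Y x =
     frechet_derivative Y (at x) (X x) - frechet_derivative X (at x) (Y x)"

text \<open>The smallest module over the ring of smooth functions on \<open>U\<close> that contains \<open>\<X>\<close> and is
  closed under the Lie bracket.\<close>

inductive_set lie_module ::
    "'a set \<Rightarrow> ('a::euclidean_space \<Rightarrow> 'a) set \<Rightarrow> ('a \<Rightarrow> 'a) set"
  for U :: "'a set" and \<X> :: "('a \<Rightarrow> 'a) set" where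
  gen: "X \<in> \<X> \<Longrightarrow> X \<in> lie_module U \<X>"
| zero: "(\<lambda>x. 0) \<in> lie_module U \<X>"
| add: "X \<in> lie_module U \<X> \<Longrightarrow> Y \<in> lie_module U \<X> \<Longrightarrow> (\<lambda>x. X x + Y x) \<in> lie_module U \<X>"
| scale: "smooth_on (f :: 'a \<Rightarrow> real) U \<Longrightarrow> X \<in> lie_module U \<X> \<Longrightarrow>
    (\<lambda>x. f x *\<^sub>R X x) \<in> lie_module U \<X>"
| bracket: "X \<in> lie_module U \<X> \<Longrightarrow> Y \<in> lie_module U \<X> \<Longrightarrow> lie_bracket X Y \<in> lie_module U \<X>"

definition lie_rank :: "'a set \<Rightarrow> ('a::euclidean_space \<Rightarrow> 'a) set \<Rightarrow> 'a \<Rightarrow> nat" where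
  "lie_rank U \<X> q = dim (span {Z q |Z. Z \<in> lie_module U \<X>})"

definition smooth_orthonormal_perp_basis ::
    "(real^'n) set \<Rightarrow> (real^'n \<Rightarrow> real^'n) \<Rightarrow> (nat \<Rightarrow> real^'n \<Rightarrow> real^'n) \<Rightarrow> bool" where
  "smooth_orthonormal_perp_basis U N X \<longleftrightarrow>
     (\<forall>i\<in>{1..CARD('n) - 1}. smooth_on (X i) U) \<and>
     (\<forall>x\<in>U. (\<forall>i\<in>{1..CARD('n) - 1}. \<forall>j\<in>{1..CARD('n) - 1}.
                X i x \<bullet> X j x = (if i = j then 1 else 0)) \<and>
             span ((\<lambda>i. X i x) ` {1..CARD('n) - 1}) = {y. orthogonal (N x) y})"

end

theory Submission
  imports Defs
begin

text \<open>Let \<open>S\<close> be the set where \<open>v = u\<close>. As \<open>\<nabla>v = \<nabla>u\<close> on \<open>S\<close>, near \<open>S\<close> the difference of the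
  curvatures is, up to a first-order error, a degenerate elliptic operator in \<open>v - u\<close> whose principal
  symbol is a positive multiple of \<open>\<Sum>\<^sub>i (N\<^sub>i\<^sup>\<bottom> \<bullet> \<xi>)\<^sup>2\<close>, and Hopf's argument shows that each \<open>N\<^sub>i\<^sup>\<bottom>\<close> is
  orthogonal to every exterior normal of \<open>S\<close>. By a theorem of Bony the fields with this property are
  closed under the Lie bracket: going along \<open>X\<close>, \<open>Y\<close>, \<open>-X\<close>, \<open>-Y\<close> for time \<open>h\<close> each, one stays
  close enough to \<open>S\<close> to see that \<open>x + h\<^sup>2 [X,Y](x)\<close> has distance \<open>o(h\<^sup>2)\<close> from \<open>S\<close>. As the Lie
  module has full rank, \<open>S\<close> has no exterior normals, so it is open.\<close>

subsection \<open>Calculus of class \<open>C\<^sup>k\<close>\<close>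

text \<open>On an open set a derivative depends only on nearby values, so agreement on
  \<open>U\<close> passes to all derivatives. This makes values outside \<open>U\<close>
  harmless.\<close>

lemma Ck_on_cong:
  assumes "open U" "Ck_on k f U" "\<And>x. x \<in> U \<Longrightarrow> f x = g x"
  shows "Ck_on k g U"
  using assms(2,3)
proof (induction k arbitrary: f g)
  case 0
  then show ?case using continuous_on_cong[of U U f g] by simp
next
  case (Suc k)
  have d: "(g has_derivative frechet_derivative f (at x)) (at x)" if "x \<in> U" for x
    using has_derivative_transform_within_open[OF _ assms(1) that Suc.prems(2)]
      Suc.prems(1) that frechet_derivative_works[of f "at x"] by auto
  have eq: "frechet_derivative f (at x) = frechet_derivative g (at x)" if "x \<in> U" for x
    using frechet_derivative_at[OF d[OF that]] .
  have "Ck_on k (\<lambda>x. frechet_derivative g (at x) h) U" for h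
    by (rule Suc.IH[of "\<lambda>x. frechet_derivative f (at x) h"]) (use Suc.prems(1) eq in auto)
  then show ?case using d by (auto intro: differentiableI)
qed

lemma Ck_on_SucI:
  assumes "open U" "\<And>x. x \<in> U \<Longrightarrow> (f has_derivative f' x) (at x)"
    and "\<And>h. Ck_on k (\<lambda>x. f' x h) U"
  shows "Ck_on (Suc k) f U"
proof -
  have "frechet_derivative f (at x) = f' x" if "x \<in> U" for x
    using frechet_derivative_at[OF assms(2)[OF that]] by simp
  then have "Ck_on k (\<lambda>x. frechet_derivative f (at x) h) U" for h
    using Ck_on_cong[OF assms(1) assms(3)[of h]] by auto
  then show ?thesis
    using assms(2) by (auto intro: differentiableI)
qed

lemma Ck_on_Suc_has_derivative:
  assumes "Ck_on (Suc k) f U" "x \<in> U"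
  shows "(f has_derivative frechet_derivative f (at x)) (at x)"
  using assms frechet_derivative_works[of f "at x"] by auto

lemma Ck_on_continuous_on:
  assumes "Ck_on k f U"
  shows "continuous_on U f"
proof (cases k)
  case (Suc l)
  then have "\<forall>x\<in>U. f differentiable (at x)" using assms by simp
  then show ?thesis by (meson continuous_at_imp_continuous_on differentiable_imp_continuous_within)
qed (use assms in simp)

lemma Ck_on_SucD: "Ck_on (Suc k) f U \<Longrightarrow> Ck_on k f U"
proof (induction k arbitrary: f)
  case 0
  then show ?case using Ck_on_continuous_on[OF 0] by simp
next
  case (Suc k)
  then show ?case by simp
qed

lemma Ck_on_const: "open U \<Longrightarrow> Ck_on k (\<lambda>x. c) U"
proof (induction k arbitrary: c)
  case (Suc k)
  then show ?case by (intro Ck_on_SucI[where f' = "\<lambda>x h. 0"]) (auto intro: has_derivative_const)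
qed simp

lemma Ck_on_add:
  assumes "open U" "Ck_on k f U" "Ck_on k g U"
  shows "Ck_on k (\<lambda>x. f x + g x) U"
  using assms(2,3)
proof (induction k arbitrary: f g)
  case 0
  then show ?case by (auto intro: continuous_on_add)
next
  case (Suc k)
  then show ?case
    by (intro Ck_on_SucI[OF assms(1) has_derivative_add[OF Ck_on_Suc_has_derivative Ck_on_Suc_has_derivative]])
       (auto simp: assms(1))
qed

lemma Ck_on_sum:
  assumes "open U" "finite I" "\<And>i. i \<in> I \<Longrightarrow> Ck_on k (f i) U"
  shows "Ck_on k (\<lambda>x. \<Sum>i\<in>I. f i x) U"
  using assms(2,3)
  by (induction I) (auto intro: Ck_on_add Ck_on_const assms(1))

text \<open>By the product rule the derivative is a sum of two products of the same kind with
  factors of class \<open>C\<^sup>k\<close>, so the induction runs over both factors. Used for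
  scalar multiples and inner products.\<close>

lemma Ck_on_bilinear:
  assumes "open U" and prod: "bounded_bilinear pr" and "Ck_on k f U" "Ck_on k g U"
  shows "Ck_on k (\<lambda>x. pr (f x) (g x)) U"
  using assms(3,4)
proof (induction k arbitrary: f g)
  case 0
  then show ?case using bounded_bilinear.continuous_on[OF prod] by auto
next
  case (Suc k)
  show ?case
    by (rule Ck_on_SucI[OF assms(1) bounded_bilinear.FDERIV[OF prod
          Ck_on_Suc_has_derivative[OF Suc.prems(1)] Ck_on_Suc_has_derivative[OF Suc.prems(2)]]])
       (use Suc.prems Ck_on_SucD[OF Suc.prems(1)] Ck_on_SucD[OF Suc.prems(2)] in
         \<open>auto intro!: Ck_on_add Suc.IH simp: assms(1)\<close>)
qed

text \<open>\<open>Ck_on\<close> controls derivatives in constant directions; expanding the varying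
  direction \<open>X x\<close> in the standard basis reduces to these.\<close>

lemma Ck_on_frechet_derivative_apply:
  assumes "open U" "Ck_on (Suc k) Y U" "Ck_on k X U"
  shows "Ck_on k (\<lambda>x. frechet_derivative Y (at x) (X x)) U"
proof -
  have "Ck_on k (\<lambda>x. \<Sum>b\<in>Basis. (X x \<bullet> b) *\<^sub>R frechet_derivative Y (at x) b) U"
    using assms
    by (intro Ck_on_sum Ck_on_bilinear[OF _ bounded_bilinear_scaleR]
          Ck_on_bilinear[OF _ bounded_bilinear_inner] Ck_on_const) auto
  then show ?thesis
  proof (rule Ck_on_cong[OF assms(1)])
    fix x assume "x \<in> U"
    then have lin: "linear (frechet_derivative Y (at x))"
      using Ck_on_Suc_has_derivative[OF assms(2)] has_derivative_linear by blast
    have "frechet_derivative Y (at x) (\<Sum>b\<in>Basis. (X x \<bullet> b) *\<^sub>R b) =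
          (\<Sum>b\<in>Basis. (X x \<bullet> b) *\<^sub>R frechet_derivative Y (at x) b)"
      by (simp add: linear_sum[OF lin] linear_cmul[OF lin])
    then show "(\<Sum>b\<in>Basis. (X x \<bullet> b) *\<^sub>R frechet_derivative Y (at x) b) =
        frechet_derivative Y (at x) (X x)"
      by (simp add: euclidean_representation)
  qed
qed

lemma smooth_on_lie_bracket:
  assumes "open U" "smooth_on X U" "smooth_on Y U"
  shows "smooth_on (lie_bracket X Y) U"
  unfolding smooth_on_def
proof
  fix k
  have "Ck_on k (\<lambda>x. frechet_derivative Y (at x) (X x) +
          (-1) *\<^sub>R frechet_derivative X (at x) (Y x)) U"
    using assms unfolding smooth_on_def
    by (intro Ck_on_add Ck_on_frechet_derivative_apply
          Ck_on_bilinear[OF _ bounded_bilinear_scaleR] Ck_on_const) auto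
  then show "Ck_on k (lie_bracket X Y) U"
    by (rule Ck_on_cong[OF assms(1)]) (simp add: lie_bracket_def)
qed

text \<open>Smoothness of every member is what allows the bracket step of the tangency argument to
  be iterated through the module.\<close>

lemma smooth_on_lie_module:
  assumes "open U" "\<And>X. X \<in> \<X> \<Longrightarrow> smooth_on X U" "Z \<in> lie_module U \<X>"
  shows "smooth_on Z U"
  using assms(3)
proof induction
  case (gen X)
  then show ?case by (rule assms(2))
next
  case zero
  then show ?case by (simp add: smooth_on_def Ck_on_const[OF assms(1)])
next
  case (add X Y)
  then show ?case using Ck_on_add[OF assms(1)] unfolding smooth_on_def by blast
next
  case (scale f X)
  then show ?case using Ck_on_bilinear[OF assms(1) bounded_bilinear_scaleR] unfolding smooth_on_def by blast
next
  case (bracket X Y)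
  then show ?case using smooth_on_lie_bracket[OF assms(1)] by simp
qed

text \<open>The sum of \<open>norm (?D y b)\<close> over the standard basis dominates the operator
  norm and is continuous directly by the definition of \<open>Ck_on\<close>.\<close>

lemma C1_derivative_bounded:
  fixes X :: "'a::euclidean_space \<Rightarrow> 'b::real_normed_vector"
  assumes "Ck_on 1 X U" "compact K" "K \<subseteq> U"
  obtains M where "0 \<le> M" "\<And>y h. y \<in> K \<Longrightarrow> norm (frechet_derivative X (at y) h) \<le> M * norm h"
proof -
  let ?D = "\<lambda>y. frechet_derivative X (at y)"
  have C: "Ck_on (Suc 0) X U" using assms(1) by simp
  have "continuous_on K (\<lambda>y. \<Sum>b\<in>Basis. norm (?D y b))"
    using C continuous_on_subset[OF _ assms(3)]
    by (intro continuous_on_sum continuous_on_norm) auto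
  then have "bounded ((\<lambda>y. \<Sum>b\<in>Basis. norm (?D y b)) ` K)"
    by (intro compact_imp_bounded compact_continuous_image assms(2))
  then obtain M where M: "M > 0" "\<And>y. y \<in> K \<Longrightarrow> (\<Sum>b\<in>Basis. norm (?D y b)) \<le> M"
    unfolding bounded_pos by (auto simp: sum_nonneg)
  have "norm (?D y h) \<le> M * norm h" if "y \<in> K" for y h
  proof -
    have lin: "linear (?D y)"
      using Ck_on_Suc_has_derivative[OF C] has_derivative_linear assms(3) that by blast
    have "?D y h = (\<Sum>b\<in>Basis. (h \<bullet> b) *\<^sub>R ?D y b)"
      using linear_sum[OF lin, of "\<lambda>b. (h \<bullet> b) *\<^sub>R b" Basis]
      by (simp add: linear_cmul[OF lin] euclidean_representation)
    also have "norm \<dots> \<le> (\<Sum>b\<in>Basis. norm h * norm (?D y b))"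
      by (intro sum_norm_le) (auto intro!: mult_right_mono Basis_le_norm)
    also have "\<dots> \<le> M * norm h"
      using mult_left_mono[OF M(2)[OF that], of "norm h"] by (simp add: sum_distrib_left mult.commute)
    finally show ?thesis .
  qed
  then show thesis using M(1) that[of M] by simp
qed

lemma C1_Lipschitz_on_cball:
  fixes X :: "'a::euclidean_space \<Rightarrow> 'b::real_normed_vector"
  assumes "Ck_on 1 X U" "cball x R \<subseteq> U"
  obtains L where "0 \<le> L"
    "\<And>y z. y \<in> cball x R \<Longrightarrow> z \<in> cball x R \<Longrightarrow> norm (X y - X z) \<le> L * norm (y - z)"
proof -
  obtain L where L: "0 \<le> L" "\<And>y h. y \<in> cball x R \<Longrightarrow> norm (frechet_derivative X (at y) h) \<le> L * norm h"
    using C1_derivative_bounded[OF assms(1) compact_cball assms(2)] by blast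
  have C: "Ck_on (Suc 0) X U" using assms(1) by simp
  have "norm (X y - X z) \<le> L * norm (y - z)" if "y \<in> cball x R" "z \<in> cball x R" for y z
    using that assms(2) L(2)
    by (intro differentiable_bound[of "cball x R" X "\<lambda>y. frechet_derivative X (at y)"])
       (auto intro!: has_derivative_at_withinI Ck_on_Suc_has_derivative[OF C] onorm_le)
  then show thesis using L(1) that by blast
qed

subsection \<open>Bony tangency and the Lie bracket\<close>

text \<open>Consider the last time at which \<open>g\<close> is nonpositive. If \<open>g\<close>
  vanishes there, \<open>step\<close> leads beyond it; if \<open>g\<close> is negative there, the
  intermediate value theorem gives a later zero. So that time is \<open>b\<close>.\<close>

lemma right_barrier:
  fixes g :: "real \<Rightarrow> real"
  assumes "continuous_on {a..b} g" "a \<le> b" "g a \<le> 0"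
    and step: "\<And>s. a \<le> s \<Longrightarrow> s < b \<Longrightarrow> g s = 0 \<Longrightarrow> \<exists>d>0. \<forall>r. 0 < r \<and> r < d \<longrightarrow> g (s + r) \<le> 0"
  shows "g b \<le> 0"
proof (rule ccontr)
  assume gb: "\<not> g b \<le> 0"
  define A where "A = {s \<in> {a..b}. g s \<le> 0}"
  have "closed A"
    unfolding A_def using continuous_closed_preimage[OF assms(1), of "{..0}"]
    by (simp add: vimage_def Int_def conj_commute)
  moreover have A: "a \<in> A" "bdd_above A" unfolding A_def using assms by (auto intro!: bdd_aboveI[of _ b])
  ultimately have s: "Sup A \<in> A" by (intro closed_contains_Sup) auto
  let ?s = "Sup A"
  have up: "t \<le> ?s" if "t \<in> A" for t using cSup_upper[OF that A(2)] .
  have sb: "a \<le> ?s" "?s < b" "g ?s \<le> 0"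
    using s gb by (auto simp: A_def order_less_le)
  show False
  proof (cases "g ?s = 0")
    case True
    then obtain d where d: "d > 0" "\<And>r. 0 < r \<Longrightarrow> r < d \<Longrightarrow> g (?s + r) \<le> 0"
      using step[OF sb(1,2)] by blast
    define r where "r = min (d/2) (b - ?s)"
    have r: "0 < r" "r < d" "?s + r \<le> b" using d(1) sb by (auto simp: r_def)
    then have "?s + r \<in> A" using d(2) sb by (auto simp: A_def)
    then show False using up[of "?s + r"] r by auto
  next
    case False
    have "continuous_on {?s..b} g" using continuous_on_subset[OF assms(1)] sb by auto
    then obtain t where "?s \<le> t" "t \<le> b" "g t = 0"
      using IVT'[of g ?s 0 b] sb gb by auto
    then show False using up[of t] False sb by (auto simp: A_def)
  qed
qed

text \<open>A nonzero \<open>c - y\<close> with this empty ball is an exterior normal to \<open>S\<close> at \<open>y\<close> in Bony's sense.\<close>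

definition tangent_field :: "'a::euclidean_space set \<Rightarrow> ('a \<Rightarrow> 'a) \<Rightarrow> bool" where
  "tangent_field S X \<longleftrightarrow> (\<forall>y\<in>S. \<forall>c. ball c (dist c y) \<inter> S = {} \<longrightarrow> X y \<bullet> (c - y) = 0)"

text \<open>In the applications \<open>S\<close> is closed only relative to \<open>U\<close>, so
  distances are taken to its piece in \<open>cball x R\<close>. As \<open>c\<close> is within
  \<open>R/2\<close> of \<open>x\<close>, a point of \<open>S\<close> closer to \<open>c\<close>
  than that piece would itself belong to the piece.\<close>

lemma nearest_point_empty_ball:
  fixes S :: "'a::euclidean_space set"
  assumes "closed (S \<inter> cball x R)" "x \<in> S" "dist c x < R/2"
  obtains y where "y \<in> S \<inter> cball x R" "dist y x < R" "infdist c (S \<inter> cball x R) = dist c y"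
    "ball c (dist c y) \<inter> S = {}"
proof -
  let ?K = "S \<inter> cball x R"
  have R: "R > 0" using assms(3) zero_le_dist[of c x] by linarith
  have xK: "x \<in> ?K" using assms(2) R by auto
  obtain y where y: "y \<in> ?K" "infdist c ?K = dist c y"
    using infdist_attains_inf[OF assms(1), of c] xK by blast
  have le: "dist c y \<le> dist c x" using infdist_le[OF xK, of c] y(2) by simp
  have near: "dist z x < R" if "dist c z \<le> dist c y" for z
    using dist_triangle[of z x c] that le assms(3) by (simp add: dist_commute)
  have "ball c (dist c y) \<inter> S = {}"
  proof (rule ccontr)
    assume "\<not> ?thesis"
    then obtain z where z: "z \<in> S" "dist c z < dist c y" by auto
    then have "z \<in> ?K" using near[of z] by (auto simp: dist_commute)
    then show False using infdist_le[of z ?K c] z y(2) by auto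
  qed
  then show thesis using that y near[of y] by auto
qed

text \<open>The Gronwall estimate below replaces the invariance of \<open>S\<close> under the flow of \<open>X\<close>, so that no
  existence theorem for ordinary differential equations is needed.\<close>

lemma infdist_along_approximate_integral_curve:
  fixes X :: "'a::euclidean_space \<Rightarrow> 'a"
  assumes "closed (S \<inter> cball x R)" "x \<in> S" and tan: "tangent_field S X"
    and Lip: "\<And>y z. y \<in> cball x R \<Longrightarrow> z \<in> cball x R \<Longrightarrow> norm (X y - X z) \<le> L * norm (y - z)"
    and "0 \<le> L" "0 \<le> h" "L * h \<le> 1/2" "0 \<le> e"
    and der: "\<And>s. 0 \<le> s \<Longrightarrow> s \<le> h \<Longrightarrow> (c has_vector_derivative c' s) (at s)"
    and near: "\<And>s. 0 \<le> s \<Longrightarrow> s \<le> h \<Longrightarrow> dist (c s) x < R/2"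
    and err: "\<And>s. 0 \<le> s \<Longrightarrow> s \<le> h \<Longrightarrow> norm (c' s - X (c s)) \<le> e"
  shows "infdist (c h) (S \<inter> cball x R) \<le> 2 * infdist (c 0) (S \<inter> cball x R) + 2 * h * e"
proof -
  let ?K = "S \<inter> cball x R"
  let ?d = "\<lambda>s. infdist (c s) ?K"
  \<comment> \<open>The slack \<open>\<eta>\<close> makes the barrier positive and the comparison
    strict; it tends to zero at the end.\<close>
  have main: "?d h \<le> 2 * ?d 0 + 2 * h * e + (2 + h) * \<eta>" if "\<eta> > 0" for \<eta>
  proof -
    define d0 where "d0 = ?d 0 + \<eta>"
    \<comment> \<open>The slope exceeds \<open>L * b s + e\<close> throughout: since
      \<open>L * h \<le> 1/2\<close>, the growth of the barrier accounts for at most half of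
      \<open>\<kappa>\<close>, and \<open>L * d0 + e\<close> is less than the other half.\<close>
    define \<kappa> where "\<kappa> = 2 * (L * d0 + e) + \<eta>"
    define b where "b = (\<lambda>s. d0 + \<kappa> * s)"
    have d0: "d0 > 0" using that infdist_nonneg[of "c 0" ?K] by (simp add: d0_def)
    have \<kappa>: "\<kappa> > 0" using that d0 assms by (simp add: \<kappa>_def add_nonneg_pos)
    have bpos: "b s > 0" if "0 \<le> s" for s using that d0 \<kappa> by (simp add: b_def add_pos_nonneg)
    have bL: "L * b s + e < \<kappa>" if "0 \<le> s" "s \<le> h" for s
    proof -
      have "L * s \<le> 1/2" using mult_left_mono[OF that(2) assms(5)] assms(7) by linarith
      then have "\<kappa> * (L * s) \<le> \<kappa> * (1/2)" using \<kappa> by (intro mult_left_mono) auto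
      moreover have "L * b s = L * d0 + \<kappa> * (L * s)" by (simp add: b_def algebra_simps)
      ultimately show ?thesis using \<open>\<eta> > 0\<close> \<kappa>_def by (simp add: algebra_simps)
    qed
    define g where "g = (\<lambda>s. (?d s)\<^sup>2 - (b s)\<^sup>2)"
    have "g h \<le> 0"
    proof (rule right_barrier[of 0 h g])
      have "continuous_on {0..h} c"
        using der by (intro continuous_at_imp_continuous_on ballI has_vector_derivative_continuous) auto
      then show "continuous_on {0..h} g" unfolding g_def b_def
        by (intro continuous_intros) 
      show "g 0 \<le> 0" using infdist_nonneg[of "c 0" ?K] that
        by (auto simp: g_def b_def d0_def intro!: power_mono)
    next
      fix s assume s: "0 \<le> s" "s < h" "g s = 0"
      obtain y where y: "y \<in> ?K" "?d s = dist (c s) y" "ball (c s) (dist (c s) y) \<inter> S = {}"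
        using nearest_point_empty_ball[OF assms(1,2) near[of s]] s by auto
      define \<nu> where "\<nu> = c s - y"
      have nb: "norm \<nu> = b s"
        using s y bpos[of s] infdist_nonneg[of "c s" ?K]
        by (simp add: g_def \<nu>_def dist_norm power2_eq_iff_nonneg less_imp_le)
      \<comment> \<open>As \<open>\<nu>\<close> is normal to \<open>S\<close> at \<open>y\<close>,
        the component of \<open>c' s\<close> along it comes only from the error \<open>e\<close> and
        from the variation of \<open>X\<close> between \<open>y\<close> and
        \<open>c s\<close>.\<close>
      have "X y \<bullet> \<nu> = 0" using tan y unfolding tangent_field_def \<nu>_def by blast
      then have "c' s \<bullet> \<nu> = (c' s - X (c s)) \<bullet> \<nu> + (X (c s) - X y) \<bullet> \<nu>"
        by (simp add: inner_diff_left)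
      also have "\<dots> \<le> e * norm \<nu> + (L * norm \<nu>) * norm \<nu>"
      proof (intro add_mono)
        show "(c' s - X (c s)) \<bullet> \<nu> \<le> e * norm \<nu>"
          using norm_cauchy_schwarz[of "c' s - X (c s)" \<nu>] mult_right_mono[OF err[of s], of "norm \<nu>"] s by simp
        have "c s \<in> cball x R" using near[of s] s zero_le_dist[of "c s" x] 
          unfolding mem_cball dist_commute[of x] by linarith
        then show "(X (c s) - X y) \<bullet> \<nu> \<le> (L * norm \<nu>) * norm \<nu>"
          using norm_cauchy_schwarz[of "X (c s) - X y" \<nu>] 
            mult_right_mono[OF Lip[of "c s" y], of "norm \<nu>"] y by (simp add: \<nu>_def)
      qed
      also have "\<dots> = (L * b s + e) * b s" by (simp add: nb algebra_simps)
      also have "\<dots> < \<kappa> * b s" using bL[of s] bpos[of s] s by (intro mult_strict_right_mono) auto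
      finally have neg: "2 * (c' s \<bullet> \<nu>) - 2 * (\<kappa> * b s) < 0" by simp
      \<comment> \<open>The distance to \<open>S\<close> may fail to be differentiable. The squared
        distance to the fixed point \<open>y\<close> is differentiable and bounds its square from
        above, with equality at time \<open>s\<close>.\<close>
      define q where "q = (\<lambda>t. (c t - y) \<bullet> (c t - y) - (b t)\<^sup>2)"
      have cd: "(c has_derivative (\<lambda>t. t *\<^sub>R c' s)) (at s)"
        using der[of s] s by (simp add: has_vector_derivative_def)
      have "(q has_derivative (*) (2 * (c' s \<bullet> \<nu>) - 2 * (\<kappa> * b s))) (at s)"
        unfolding q_def b_def
        by (rule derivative_eq_intros cd refl | simp)+
           (auto simp: \<nu>_def b_def fun_eq_iff algebra_simps inner_commute power2_eq_square)
      then have "DERIV q s :> 2 * (c' s \<bullet> \<nu>) - 2 * (\<kappa> * b s)"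
        by (simp only: has_field_derivative_def)
      from DERIV_neg_dec_right[OF this neg] obtain d where
        d: "d > 0" "\<And>r. 0 < r \<Longrightarrow> r < d \<Longrightarrow> q (s + r) < q s" by blast
      have "q s = 0" using nb by (simp add: q_def \<nu>_def[symmetric] power2_norm_eq_inner[symmetric])
      moreover have "g t \<le> q t" for t
        using power_mono[OF infdist_le[OF y(1), of "c t"] infdist_nonneg, of 2]
        by (simp add: g_def q_def dist_norm power2_norm_eq_inner)
      ultimately have "g (s + r) \<le> 0" if "0 < r" "r < d" for r 
        using d(2)[OF that] by (metis less_le_trans less_imp_le order_trans)
      then show "\<exists>d>0. \<forall>r. 0 < r \<and> r < d \<longrightarrow> g (s + r) \<le> 0" using d(1) by blast
    qed (use assms in auto)
    then have "?d h \<le> b h"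
      using bpos[of h] assms(6) by (auto simp: g_def intro: power2_le_imp_le)
    also have "b h = d0 + 2 * (L * h) * d0 + 2 * h * e + h * \<eta>"
      by (simp add: b_def \<kappa>_def algebra_simps)
    \<comment> \<open>Here the factor 2 in front of the initial distance arises.\<close>
    also have "\<dots> \<le> d0 + 1 * d0 + 2 * h * e + h * \<eta>"
      using mult_right_mono[OF assms(7), of d0] d0 by (simp add: algebra_simps)
    finally show ?thesis by (simp add: d0_def algebra_simps)
  qed
  show ?thesis
  proof (rule field_le_epsilon)
    fix \<epsilon> :: real assume "\<epsilon> > 0"
    then show "?d h \<le> 2 * ?d 0 + 2 * h * e + \<epsilon>"
      using main[of "\<epsilon> / (2 + h)"] assms(6) by simp
  qed
qed

text \<open>The curve in the proof is the second-order Taylor expansion of an integral curve of the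
  linearisation of \<open>X\<close> at \<open>x\<close>.\<close>

lemma second_order_approach_step:
  fixes X :: "'a::euclidean_space \<Rightarrow> 'a"
  assumes cl: "closed (S \<inter> cball x R)" "x \<in> S" "R > 0" and tan: "tangent_field S X"
    and Lip: "\<And>y z. y \<in> cball x R \<Longrightarrow> z \<in> cball x R \<Longrightarrow> norm (X y - X z) \<le> L * norm (y - z)"
    and "0 \<le> L" and der: "(X has_derivative A) (at x)"
    and ap: "\<And>\<epsilon>. \<epsilon> > 0 \<Longrightarrow> \<forall>\<^sub>F h in at_right 0.
          infdist (x + h *\<^sub>R p + h\<^sup>2 *\<^sub>R q) (S \<inter> cball x R) \<le> \<epsilon> * h\<^sup>2"
    and "\<epsilon> > 0"
  shows "\<forall>\<^sub>F h in at_right 0.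
      infdist (x + h *\<^sub>R (p + X x) + h\<^sup>2 *\<^sub>R (q + A p + (1/2) *\<^sub>R A (X x))) (S \<inter> cball x R) \<le> \<epsilon> * h\<^sup>2"
proof -
  let ?K = "S \<inter> cball x R"
  define a where "a = X x"
  have lin: "linear A" using der has_derivative_linear by blast
  obtain k where k: "k > 0" "\<And>z. norm (A z) \<le> norm z * k"
    using bounded_linear.pos_bounded[OF has_derivative_bounded_linear[OF der]] by blast
  \<comment> \<open>\<open>h\<^sup>2 * C\<close> will bound the second-order displacement from
    \<open>x\<close>, and \<open>h * D\<close> the whole displacement.\<close>
  define C where "C = norm q + norm (A p) + norm (A a)"
  define D where "D = norm p + norm a + C + 1"
  have CD: "C \<ge> 0" "D > 0" by (auto simp: C_def D_def intro: add_nonneg_pos add_nonneg_nonneg)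
  define \<eta> where "\<eta> = \<epsilon> / (8 * D)"
  have \<eta>: "\<eta> > 0" using \<open>\<epsilon> > 0\<close> CD by (simp add: \<eta>_def)
  obtain \<delta> where \<delta>: "\<delta> > 0" "\<And>z. norm (z - x) < \<delta> \<Longrightarrow> norm (X z - X x - A (z - x)) \<le> \<eta> * norm (z - x)"
    using der \<eta> unfolding has_derivative_at_alt by blast
  \<comment> \<open>The bounds ensure, in order: \<open>h \<le> 1\<close>; the curve stays where the
    linearisation is accurate up to \<open>\<eta>\<close>; it stays in the half ball;
    \<open>L * h \<le> 1/2\<close>; the second-order part of \<open>2 * h * e\<close> is at most
    \<open>(\<epsilon>/4) * h\<^sup>2\<close>. The choice of \<open>\<eta>\<close> gives the same
    bound for the other part.\<close>
  define H where "H = min 1 (min (\<delta> / D) (min (R / (2*D)) (min (1/(2 * (L+1))) (\<epsilon> / (8 * (k * C + 1))))))"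
  have kC: "k * C + 1 > 0" using k(1) CD by (simp add: add_nonneg_pos)
  have H: "H > 0" using \<delta>(1) CD cl(3) \<open>0 \<le> L\<close> \<open>\<epsilon> > 0\<close> kC by (auto simp: H_def)
  have "\<forall>\<^sub>F h in at_right (0::real). h < H" using H eventually_at_right_field by blast
  moreover have "\<forall>\<^sub>F h in at_right (0::real). 0 < h" by (simp add: eventually_at_right_less)
  moreover have "\<forall>\<^sub>F h in at_right 0. infdist (x + h *\<^sub>R p + h\<^sup>2 *\<^sub>R q) ?K \<le> (\<epsilon>/4) * h\<^sup>2"
    using ap[of "\<epsilon>/4"] \<open>\<epsilon> > 0\<close> by simp
  ultimately show ?thesis
  proof eventually_elim
    fix h :: real
    assume hH: "h < H" and h: "0 < h"
      and ih: "infdist (x + h *\<^sub>R p + h\<^sup>2 *\<^sub>R q) ?K \<le> (\<epsilon>/4) * h\<^sup>2"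
    have h1: "h \<le> 1" using hH by (simp add: H_def)
    have h2: "h * D < \<delta>" using hH CD by (simp add: H_def pos_less_divide_eq)
    have h3: "h * D < R/2" using hH CD by (simp add: H_def field_simps)
    have "h < 1/(2 * (L+1))" using hH by (simp add: H_def)
    then have h4: "L * h \<le> 1/2" using \<open>0 \<le> L\<close> h by (simp add: field_simps)
    have "h < \<epsilon> / (8 * (k * C + 1))" using hH by (simp add: H_def)
    then have "h * (8 * (k * C + 1)) < \<epsilon>" using kC by (simp add: pos_less_divide_eq)
    then have h5: "8 * (k * C) * h \<le> \<epsilon>" using h by (simp add: algebra_simps)
    \<comment> \<open>The curve joins the given point (\<open>s = 0\<close>) to the new one
      (\<open>s = h\<close>); its velocity is \<open>X x\<close> plus \<open>A\<close> of the
      first-order displacement \<open>h *\<^sub>R p + s *\<^sub>R a\<close>.\<close>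
    define c where "c = (\<lambda>s. x + h *\<^sub>R p + h\<^sup>2 *\<^sub>R q + s *\<^sub>R (a + h *\<^sub>R A p) + (s\<^sup>2/2) *\<^sub>R A a)"
    define c' where "c' = (\<lambda>s. a + h *\<^sub>R A p + s *\<^sub>R A a)"
    define e where "e = \<eta> * (h * D) + k * (h\<^sup>2 * C)"
    have rest: "norm (c s - x - (h *\<^sub>R p + s *\<^sub>R a)) \<le> h\<^sup>2 * C" if s: "0 \<le> s" "s \<le> h" for s
    proof -
      have "c s - x - (h *\<^sub>R p + s *\<^sub>R a) = h\<^sup>2 *\<^sub>R q + (s * h) *\<^sub>R A p + (s\<^sup>2/2) *\<^sub>R A a"
        by (simp add: c_def algebra_simps)
      also have "norm \<dots> \<le> h\<^sup>2 * norm q + h\<^sup>2 * norm (A p) + h\<^sup>2 * norm (A a)"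
      proof (intro norm_triangle_le add_mono)
        have "s * h \<le> h * h" using s h by (intro mult_right_mono) auto
        then show "norm ((s * h) *\<^sub>R A p) \<le> h\<^sup>2 * norm (A p)"
          using s h by (auto simp: abs_mult power2_eq_square intro!: mult_right_mono)
        have "s\<^sup>2 \<le> h\<^sup>2" using s by (intro power_mono) auto
        then have "s\<^sup>2/2 \<le> h\<^sup>2" using zero_le_power2[of h] by linarith
        then show "norm ((s\<^sup>2/2) *\<^sub>R A a) \<le> h\<^sup>2 * norm (A a)"
          using mult_right_mono[of "s\<^sup>2/2" "h\<^sup>2" "norm (A a)"] by simp
      qed simp
      finally show ?thesis by (simp add: C_def algebra_simps)
    qed
    have cn: "norm (c s - x) < h * D" if s: "0 \<le> s" "s \<le> h" for s
    proof -
      have "norm (c s - x) \<le> norm (c s - x - (h *\<^sub>R p + s *\<^sub>R a)) + norm (h *\<^sub>R p + s *\<^sub>R a)"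
        by (metis diff_add_cancel norm_triangle_ineq)
      also have "\<dots> \<le> h\<^sup>2 * C + (h * norm p + h * norm a)"
        using s h by (intro add_mono rest norm_triangle_le) (auto intro: mult_right_mono)
      also have "\<dots> \<le> h * C + (h * norm p + h * norm a)"
        using h h1 CD mult_right_mono[OF mult_left_mono[OF h1, of h], of C] by (simp add: power2_eq_square)
      also have "\<dots> < h * D" using h by (simp add: D_def algebra_simps)
      finally show ?thesis .
    qed
    have "infdist (c h) ?K \<le> 2 * infdist (c 0) ?K + 2 * h * e"
    proof (rule infdist_along_approximate_integral_curve[OF cl(1,2) tan Lip \<open>0 \<le> L\<close> _ h4, where c' = c'])
      show "0 \<le> e" using \<eta> h CD k(1) by (simp add: e_def)
    next
      fix s assume s: "0 \<le> s" "s \<le> h"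
      show "(c has_vector_derivative c' s) (at s)"
        unfolding c_def c'_def has_vector_derivative_def
        by (rule derivative_eq_intros refl | simp)+ (simp add: fun_eq_iff algebra_simps)
      show "dist (c s) x < R/2" using cn[OF s] h3 by (simp add: dist_norm)
      \<comment> \<open>The error consists of the Taylor remainder of \<open>X\<close> at
        \<open>x\<close> and the image under \<open>A\<close> of the second-order
        displacement.\<close>
      have "c' s - X (c s) = - (X (c s) - X x - A (c s - x)) - A (c s - x - (h *\<^sub>R p + s *\<^sub>R a))"
        by (simp add: c'_def a_def linear_diff[OF lin] linear_add[OF lin] linear_cmul[OF lin] algebra_simps)
      also have "norm \<dots> \<le> \<eta> * (h * D) + k * (h\<^sup>2 * C)"
      proof (rule order_trans[OF norm_triangle_ineq4 add_mono])
        have "norm (X (c s) - X x - A (c s - x)) \<le> \<eta> * norm (c s - x)"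
          using cn[OF s] h2 by (intro \<delta>(2)) auto
        also have "\<dots> \<le> \<eta> * (h * D)" using cn[OF s] \<eta> by (intro mult_left_mono) auto
        finally show "norm (- (X (c s) - X x - A (c s - x))) \<le> \<eta> * (h * D)"
            by (simp only: norm_minus_cancel)
        show "norm (A (c s - x - (h *\<^sub>R p + s *\<^sub>R a))) \<le> k * (h\<^sup>2 * C)"
          unfolding mult.commute[of k] using k(1)
          by (intro order_trans[OF k(2) mult_right_mono[OF rest[OF s]]]) simp
      qed
      finally show "norm (c' s - X (c s)) \<le> e" by (simp add: e_def)
    qed (use h in auto)
    also have "c 0 = x + h *\<^sub>R p + h\<^sup>2 *\<^sub>R q" by (simp add: c_def)
    also have "2 * infdist \<dots> ?K + 2 * h * e \<le> 2 * ((\<epsilon>/4) * h\<^sup>2) + (\<epsilon>/4 + \<epsilon>/4) * h\<^sup>2"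
    proof (intro add_mono mult_left_mono ih)
      have "2 * h * e = (2 * (\<eta> * D) + 2 * (k * C) * h) * h\<^sup>2"
        by (simp add: e_def power2_eq_square algebra_simps)
      also have "\<dots> \<le> (\<epsilon>/4 + \<epsilon>/4) * h\<^sup>2"
        using h5 CD by (intro mult_right_mono add_mono) (auto simp: \<eta>_def)
      finally show "2 * h * e \<le> (\<epsilon>/4 + \<epsilon>/4) * h\<^sup>2" .
    qed simp
    also have "\<dots> = \<epsilon> * h\<^sup>2" by (simp add: algebra_simps)
    also have "c h = x + h *\<^sub>R (p + X x) + h\<^sup>2 *\<^sub>R (q + A p + (1/2) *\<^sub>R A (X x))"
      by (simp add: c_def a_def power2_eq_square algebra_simps)
    finally show "infdist (x + h *\<^sub>R (p + X x) + h\<^sup>2 *\<^sub>R (q + A p + (1/2) *\<^sub>R A (X x))) ?K \<le> \<epsilon> * h\<^sup>2" .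
  qed
qed

text \<open>If \<open>Z\<close> pointed into the ball, \<open>x + h\<^sup>2 *\<^sub>R Z\<close>
  would lie at depth of order h^2 inside it, yet within o(h^2) of \<open>S\<close>, which the ball
  avoids. Only positive multiples of \<open>Z\<close> occur, hence an inequality and not an
  equation.\<close>

lemma second_order_approach_normal:
  fixes Z :: "'a::euclidean_space"
  assumes cl: "closed (S \<inter> cball x R)" "x \<in> S" "R > 0" 
    and ap: "\<And>\<epsilon>. \<epsilon> > 0 \<Longrightarrow> \<forall>\<^sub>F h in at_right 0. infdist (x + h\<^sup>2 *\<^sub>R Z) (S \<inter> cball x R) \<le> \<epsilon> * h\<^sup>2"
    and empty: "ball c (dist c x) \<inter> S = {}"
  shows "Z \<bullet> (c - x) \<le> 0"
proof (rule ccontr)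
  assume "\<not> ?thesis"
  then have pos: "Z \<bullet> (c - x) > 0" by simp
  let ?\<nu> = "c - x"
  define \<theta> where "\<theta> = Z \<bullet> ?\<nu>"
  have \<nu>: "norm ?\<nu> > 0" using pos by auto
  \<comment> \<open>With this value the deviation of the nearby point of \<open>S\<close> costs at
    most half of the gain \<open>h\<^sup>2 * \<theta>\<close> along the normal; what is left cannot
    be of order h^4.\<close>
  define \<epsilon> where "\<epsilon> = \<theta> / (2 * norm ?\<nu>)"
  have \<epsilon>: "\<epsilon> > 0" using pos \<nu> by (simp add: \<epsilon>_def \<theta>_def)
  define B where "B = (norm Z + \<epsilon>)\<^sup>2"
  have B: "B > 0" using \<epsilon> norm_ge_zero[of Z] unfolding B_def by (intro zero_less_power) linarith
  have "\<forall>\<^sub>F h in at_right (0::real). h < min 1 (\<theta> / B)"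
    unfolding eventually_at_right_field using pos B
    by (intro exI[of _ "min 1 (\<theta> / B)"]) (simp add: \<theta>_def)
  moreover have "\<forall>\<^sub>F h in at_right (0::real). 0 < h" by (simp add: eventually_at_right_less)
  ultimately have "\<forall>\<^sub>F h in at_right (0::real). False"
    using ap[OF \<epsilon>]
  proof eventually_elim
    fix h :: real assume hm: "h < min 1 (\<theta> / B)" and h: "0 < h" 
      and inf: "infdist (x + h\<^sup>2 *\<^sub>R Z) (S \<inter> cball x R) \<le> \<epsilon> * h\<^sup>2"
    have "x \<in> S \<inter> cball x R" using cl by simp
    then obtain y where "y \<in> S \<inter> cball x R"
      "infdist (x + h\<^sup>2 *\<^sub>R Z) (S \<inter> cball x R) = dist (x + h\<^sup>2 *\<^sub>R Z) y"
      using infdist_attains_inf[OF cl(1), of "x + h\<^sup>2 *\<^sub>R Z"] by blast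
    with inf have y: "y \<in> S" "dist (x + h\<^sup>2 *\<^sub>R Z) y \<le> \<epsilon> * h\<^sup>2" by auto
    define r where "r = y - x - h\<^sup>2 *\<^sub>R Z"
    have r: "norm r \<le> \<epsilon> * h\<^sup>2" using y(2) by (simp add: r_def dist_norm norm_minus_commute algebra_simps)
    have yx: "y - x = h\<^sup>2 *\<^sub>R Z + r" by (simp add: r_def)
    have "norm ?\<nu> \<le> norm (?\<nu> - (y - x))"
      using empty y(1) by (force simp: dist_norm disjoint_iff not_less algebra_simps)
    then have "(norm ?\<nu>)\<^sup>2 \<le> (norm (?\<nu> - (y - x)))\<^sup>2" by (intro power_mono) auto
    then have 1: "2 * ((y - x) \<bullet> ?\<nu>) \<le> (norm (y - x))\<^sup>2"
      unfolding power2_norm_eq_inner by (simp add: inner_diff_left inner_diff_right inner_commute)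
    have "norm (y - x) \<le> h\<^sup>2 * (norm Z + \<epsilon>)"
      unfolding yx using r by (intro norm_triangle_le) (simp add: algebra_simps)
    then have "(norm (y - x))\<^sup>2 \<le> (h\<^sup>2 * (norm Z + \<epsilon>))\<^sup>2" by (intro power_mono) auto
    also have "\<dots> = h\<^sup>2 * (h\<^sup>2 * B)" by (simp add: B_def power2_eq_square algebra_simps)
    finally have 2: "(norm (y - x))\<^sup>2 \<le> h\<^sup>2 * (h\<^sup>2 * B)" .
    have "\<bar>r \<bullet> ?\<nu>\<bar> \<le> \<epsilon> * h\<^sup>2 * norm ?\<nu>"
      using Cauchy_Schwarz_ineq2[of r ?\<nu>] mult_right_mono[OF r, of "norm ?\<nu>"] by simp
    also have "\<dots> = h\<^sup>2 * (\<theta> / 2)" using \<nu> by (simp add: \<epsilon>_def)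
    finally have 3: "\<bar>r \<bullet> ?\<nu>\<bar> \<le> h\<^sup>2 * (\<theta> / 2)" .
    have "(y - x) \<bullet> ?\<nu> = h\<^sup>2 * \<theta> + r \<bullet> ?\<nu>" by (simp add: yx inner_add_left \<theta>_def)
    then have "h\<^sup>2 * \<theta> \<le> h\<^sup>2 * (h\<^sup>2 * B)" using 1 2 3 by linarith
    then have "\<theta> \<le> h\<^sup>2 * B" using h mult_le_cancel_left_pos[of "h\<^sup>2" \<theta> "h\<^sup>2 * B"] zero_less_power[OF h, of 2] by blast
    also have "\<dots> \<le> h * B" using hm h B by (intro mult_right_mono) (auto simp: power2_eq_square)
    also have "\<dots> < \<theta>" using hm B by (simp add: pos_less_divide_eq)
    finally show False by simp
  qed
  then show False by (simp add: eventually_False)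
qed

lemma closedin_Int_cball_closed:
  fixes S :: "'a::metric_space set"
  assumes "closedin (top_of_set U) S" "cball x R \<subseteq> U"
  shows "closed (S \<inter> cball x R)"
proof -
  obtain T where "closed T" "S = U \<inter> T" using assms(1) closedin_closed by blast
  moreover have "U \<inter> T \<inter> cball x R = T \<inter> cball x R" using assms(2) by blast
  ultimately show ?thesis by (simp add: closed_Int)
qed

text \<open>Each commutator path gives one inequality at every exterior normal; exchanging
  \<open>X\<close> and \<open>Y\<close> changes the sign of the bracket and gives the reverse
  inequality.\<close>

lemma tangent_field_lie_bracket:
  fixes X Y :: "'a::euclidean_space \<Rightarrow> 'a"
  assumes "open U" "closedin (top_of_set U) S" "Ck_on 1 X U" "Ck_on 1 Y U"
    and tan: "tangent_field S X" "tangent_field S Y"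
  shows "tangent_field S (lie_bracket X Y)"
proof -
  have half: "lie_bracket X Y x \<bullet> (c - x) \<le> 0"
    if C1: "Ck_on 1 X U" "Ck_on 1 Y U" and tan: "tangent_field S X" "tangent_field S Y"
      and x: "x \<in> S" and c: "ball c (dist c x) \<inter> S = {}" for X Y :: "'a \<Rightarrow> 'a" and x c
  proof -
    have "x \<in> U" using assms(2) x closedin_imp_subset by blast
    then obtain R where R: "R > 0" "cball x R \<subseteq> U" using assms(1) open_contains_cball by blast
    have cl: "closed (S \<inter> cball x R)"
      by (rule closedin_Int_cball_closed[OF assms(2) R(2)])
    define A where "A = frechet_derivative X (at x)"
    define B where "B = frechet_derivative Y (at x)"
    have dX: "(X has_derivative A) (at x)" and dY: "(Y has_derivative B) (at x)"
      using Ck_on_Suc_has_derivative[of 0 X U x] Ck_on_Suc_has_derivative[of 0 Y U x] C1 \<open>x \<in> U\<close>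
      by (simp_all add: A_def B_def)
    have lin: "linear A" "linear B" using dX dY has_derivative_linear by auto
    obtain L where L: "0 \<le> L" "\<And>y z. y \<in> cball x R \<Longrightarrow> z \<in> cball x R \<Longrightarrow> norm (X y - X z) \<le> L * norm (y - z)"
      using C1_Lipschitz_on_cball[OF C1(1) R(2)] by blast
    obtain M where M: "0 \<le> M" "\<And>y z. y \<in> cball x R \<Longrightarrow> z \<in> cball x R \<Longrightarrow> norm (Y y - Y z) \<le> M * norm (y - z)"
      using C1_Lipschitz_on_cball[OF C1(2) R(2)] by blast
    \<comment> \<open>\<open>?ap p q\<close> says that
      \<open>x + h *\<^sub>R p + h\<^sup>2 *\<^sub>R q\<close> has distance o(h^2) from
      \<open>S\<close>; each of the four rules below appends one leg of the path.\<close>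
    let ?ap = "\<lambda>p q. \<forall>\<epsilon>>0. \<forall>\<^sub>F h in at_right 0. infdist (x + h *\<^sub>R p + h\<^sup>2 *\<^sub>R q) (S \<inter> cball x R) \<le> \<epsilon> * h\<^sup>2"
    have sX: "?ap p q \<Longrightarrow> ?ap (p + X x) (q + A p + (1/2) *\<^sub>R A (X x))" for p q
      using second_order_approach_step[OF cl x R(1) tan(1) L(2) L(1) dX] by blast
    have sY: "?ap p q \<Longrightarrow> ?ap (p + Y x) (q + B p + (1/2) *\<^sub>R B (Y x))" for p q
      using second_order_approach_step[OF cl x R(1) tan(2) M(2) M(1) dY] by blast
    have neg: "tangent_field S (\<lambda>x. - X x)" "tangent_field S (\<lambda>x. - Y x)"
      using tan by (auto simp: tangent_field_def)
    have sX': "?ap p q \<Longrightarrow> ?ap (p - X x) (q - A p + (1/2) *\<^sub>R A (X x))" for p q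
      using second_order_approach_step[OF cl x R(1) neg(1) _ L(1) has_derivative_minus[OF dX]] L(2)
      by (simp add: linear_neg[OF lin(1)] norm_minus_commute)
    have sY': "?ap p q \<Longrightarrow> ?ap (p - Y x) (q - B p + (1/2) *\<^sub>R B (Y x))" for p q
      using second_order_approach_step[OF cl x R(1) neg(2) _ M(1) has_derivative_minus[OF dY]] M(2)
      by (simp add: linear_neg[OF lin(2)] norm_minus_commute)
    have "infdist x (S \<inter> cball x R) = 0" using x R(1) by (intro infdist_zero) auto
    then have "?ap 0 0" by simp
    \<comment> \<open>With a = \<open>X x\<close> and b = \<open>Y x\<close>, the first-order part
      runs through a, a + b, b, 0. At second order the terms in A a and B b cancel and B a - A b
      remains.\<close>
    from sY'[OF sX'[OF sY[OF sX[OF this]]]]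
    have "?ap 0 (B (X x) - A (Y x))"
      by (simp add: linear_add[OF lin(1)] linear_add[OF lin(2)] linear_0[OF lin(1)] linear_0[OF lin(2)]
          linear_diff[OF lin(2)] linear_diff[OF lin(1)] algebra_simps flip: scaleR_2 scaleR_add_left)
    then have "?ap 0 (lie_bracket X Y x)" by (simp add: lie_bracket_def A_def B_def)
    then show ?thesis
      using second_order_approach_normal[OF cl x R(1) _ c] by simp
  qed
  have "lie_bracket Y X x = - lie_bracket X Y x" for x by (simp add: lie_bracket_def)
  then show ?thesis
    using half[OF assms(3,4) tan] half[OF assms(4,3) tan(2,1)]
    unfolding tangent_field_def by (metis inner_minus_left neg_le_0_iff_le order_antisym)
qed

subsection \<open>The mean curvature operator\<close>

lemma has_derivative_grad:
  assumes "u differentiable (at x)"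
  shows "(u has_derivative (\<lambda>h. grad u x \<bullet> h)) (at x)"
proof -
  have d: "(u has_derivative frechet_derivative u (at x)) (at x)"
    using assms frechet_derivative_works by blast
  then have lin: "linear (frechet_derivative u (at x))" by (rule has_derivative_linear)
  have "frechet_derivative u (at x) h = grad u x \<bullet> h" for h
  proof -
    have "frechet_derivative u (at x) (\<Sum>i\<in>UNIV. h $ i *\<^sub>R axis i 1) = grad u x \<bullet> h"
      by (simp add: linear_sum[OF lin] linear_cmul[OF lin] grad_def inner_vec_def mult.commute
          del: scaleR_conv_of_real)
    then show ?thesis using basis_expansion[of h] by (simp add: scalar_mult_eq_scaleR)
  qed
  then have "frechet_derivative u (at x) = (\<lambda>h. grad u x \<bullet> h)" by auto
  then show ?thesis using d by simp
qed

lemma Ck_on_grad: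
  assumes "open U" "Ck_on (Suc k) u U"
  shows "Ck_on k (grad u) U"
proof -
  have "Ck_on k (\<lambda>x. \<Sum>i\<in>UNIV. frechet_derivative u (at x) (axis i 1) *\<^sub>R axis i 1) U"
    using assms
    by (intro Ck_on_sum Ck_on_bilinear[OF _ bounded_bilinear_scaleR] Ck_on_const) auto
  then show ?thesis
    by (rule Ck_on_cong[OF assms(1)])
       (simp add: grad_def vec_eq_iff axis_def if_distrib cong: if_cong)
qed

text \<open>For nonzero \<open>p\<close>, the trace of \<open>L\<close> over the orthogonal
  complement of \<open>p\<close>, divided by |p|. Value and derivative of grad u + F become
  independent arguments, so one can be frozen while the other varies.\<close>

definition curv_op :: "real^'n \<Rightarrow> (real^'n \<Rightarrow> real^'n) \<Rightarrow> real" where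
  "curv_op p L = ((\<Sum>i\<in>UNIV. L (axis i 1) $ i) - sgn p \<bullet> L (sgn p)) / norm p"

text \<open>Differentiating a / |a| projects \<open>L\<close> onto the complement of the unit normal
  and divides by |a|; the trace of this map is \<open>curv_op\<close>.\<close>

lemma mean_curv_eq_curv_op:
  assumes der: "((\<lambda>x. grad u x + F x) has_derivative L) (at x)" and "grad u x + F x \<noteq> 0"
  shows "mean_curv F u x = curv_op (grad u x + F x) L"
proof -
  let ?a = "\<lambda>x. grad u x + F x"
  define p where "p = ?a x"
  have p: "p \<noteq> 0" using assms(2) by (simp add: p_def)
  have lin: "linear L" using der by (rule has_derivative_linear)
  have "(norm has_derivative (\<lambda>h. sgn p \<bullet> h)) (at p)"
    using has_derivative_norm[OF p] by (simp add: inner_commute)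
  then have nd: "((\<lambda>x. norm (?a x)) has_derivative (\<lambda>h. sgn p \<bullet> L h)) (at x)"
    using has_derivative_compose[OF der, of norm] by (simp add: p_def)
  have "((\<lambda>x. ?a x /\<^sub>R norm (?a x)) has_derivative
      (\<lambda>h. L h /\<^sub>R norm p - ((sgn p \<bullet> L h) / norm p) *\<^sub>R sgn p)) (at x)"
    by (rule has_derivative_eq_rhs[OF has_derivative_scaleR[OF Deriv.has_derivative_inverse[OF _ nd] der]])
       (use p in \<open>simp_all add: fun_eq_iff sgn_div_norm inverse_eq_divide flip: p_def\<close>)
  then have fd: "frechet_derivative (normal_field F u) (at x) =
      (\<lambda>h. L h /\<^sub>R norm p - ((sgn p \<bullet> L h) / norm p) *\<^sub>R sgn p)"
    unfolding normal_field_def[abs_def] by (rule frechet_derivative_at[symmetric])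
  have "sgn p \<bullet> L (\<Sum>i\<in>UNIV. sgn p $ i *\<^sub>R axis i 1) = (\<Sum>i\<in>UNIV. (sgn p \<bullet> L (axis i 1)) * sgn p $ i)"
    by (simp add: linear_sum[OF lin] linear_cmul[OF lin] inner_sum_right mult.commute)
  then have tr: "(\<Sum>i\<in>UNIV. (sgn p \<bullet> L (axis i 1)) * sgn p $ i) = sgn p \<bullet> L (sgn p)"
    using basis_expansion[of "sgn p"] by (simp add: scalar_mult_eq_scaleR)
  have "mean_curv F u x = (\<Sum>i\<in>UNIV. L (axis i 1) $ i / norm p - (sgn p \<bullet> L (axis i 1)) * sgn p $ i / norm p)"
    unfolding mean_curv_def divergence_def trace_def jacobian_def matrix_def fd
    by (simp add: divide_inverse mult_ac)
  also have "\<dots> = curv_op p L"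
    by (simp add: curv_op_def sum_subtractf tr diff_divide_distrib flip: sum_divide_distrib)
  finally show ?thesis by (simp add: p_def)
qed

lemma curv_op_diff: "curv_op p (\<lambda>h. L h - L' h) = curv_op p L - curv_op p L'"
  by (simp add: curv_op_def sum_subtractf inner_diff_right diff_divide_distrib)

text \<open>Together with \<open>N\<close> the \<open>X j\<close> form an orthonormal basis of the
  whole space, and the trace is the same in each such basis.\<close>

lemma trace_orthonormal:
  fixes L :: "real^'n \<Rightarrow> real^'n"
  assumes lin: "linear L" and "finite I" and N: "norm N = 1"
    and on: "\<And>i j. i \<in> I \<Longrightarrow> j \<in> I \<Longrightarrow> X i \<bullet> X j = (if i = j then 1 else 0)"
    and span: "span (X ` I) = {y. orthogonal N y}"
  shows "(\<Sum>i\<in>UNIV. L (axis i 1) $ i) = (\<Sum>j\<in>I. X j \<bullet> L (X j)) + N \<bullet> L N"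
proof -
  have NN: "N \<bullet> N = 1" using N by (simp add: norm_eq_1)
  have XN: "X j \<bullet> N = 0" if "j \<in> I" for j
    using span_base[of "X j" "X ` I"] that span by (auto simp: orthogonal_def inner_commute)
  have expand: "y = (\<Sum>j\<in>I. (y \<bullet> X j) *\<^sub>R X j) + (y \<bullet> N) *\<^sub>R N" for y
  proof -
    \<comment> \<open>\<open>z\<close> lies in the span of the \<open>X j\<close> and is orthogonal
      to all of them, so it vanishes.\<close>
    define z where "z = y - (y \<bullet> N) *\<^sub>R N - (\<Sum>j\<in>I. (y \<bullet> X j) *\<^sub>R X j)"
    have "y - (y \<bullet> N) *\<^sub>R N \<in> span (X ` I)"
      unfolding span by (simp add: orthogonal_def inner_diff_right NN inner_commute)
    then have zs: "z \<in> span (X ` I)"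
      unfolding z_def by (rule span_diff) (intro span_sum span_scale span_base imageI)
    have "z \<bullet> X k = 0" if "k \<in> I" for k
    proof -
      have "(\<Sum>j\<in>I. (y \<bullet> X j) * (X j \<bullet> X k)) = (\<Sum>j\<in>I. if j = k then y \<bullet> X k else 0)"
        using on that by (intro sum.cong) auto
      then show ?thesis
        using that XN[OF that] \<open>finite I\<close>
        by (simp add: z_def inner_diff_left inner_sum_left inner_commute[of N])
    qed
    then have "orthogonal z z"
      by (intro orthogonal_to_span[OF zs]) (auto simp: orthogonal_def)
    then have "z = 0" by (simp add: orthogonal_def)
    then show ?thesis by (simp add: z_def algebra_simps)
  qed
  have parseval: "(\<Sum>i\<in>UNIV. L (axis i 1 :: real^'n) $ i) =
      (\<Sum>i\<in>UNIV. (\<Sum>j\<in>I. X j $ i * L (X j) $ i) + N $ i * L N $ i)"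
  proof (rule sum.cong[OF refl])
    fix i :: 'n
    have "L (axis i 1) = L ((\<Sum>j\<in>I. (axis i 1 \<bullet> X j) *\<^sub>R X j) + (axis i 1 \<bullet> N) *\<^sub>R N)"
      using expand[of "axis i 1"] by simp
    also have "\<dots> = (\<Sum>j\<in>I. X j $ i *\<^sub>R L (X j)) + N $ i *\<^sub>R L N"
      by (simp add: linear_add[OF lin] linear_sum[OF lin] linear_cmul[OF lin] inner_axis')
    finally show "L (axis i 1) $ i = (\<Sum>j\<in>I. X j $ i * L (X j) $ i) + N $ i * L N $ i"
      by simp
  qed
  also have "\<dots> = (\<Sum>j\<in>I. X j \<bullet> L (X j)) + N \<bullet> L N"
    unfolding sum.distrib inner_vec_def by (subst sum.swap) simp
  finally show ?thesis .
qed

text \<open>The normal direction contributes to the trace exactly the term that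
  \<open>curv_op\<close> subtracts, so only the directions \<open>X j\<close> are left.\<close>

lemma curv_op_orthonormal:
  fixes p :: "real^'n"
  assumes "linear L" "finite I" "p \<noteq> 0"
    and "\<And>i j. i \<in> I \<Longrightarrow> j \<in> I \<Longrightarrow> X i \<bullet> X j = (if i = j then 1 else 0)"
    and "span (X ` I) = {y. orthogonal (sgn p) y}"
  shows "curv_op p L = (\<Sum>j\<in>I. X j \<bullet> L (X j)) / norm p"
  using trace_orthonormal[OF assms(1,2) _ assms(4,5)] assms(3)
  by (simp add: curv_op_def norm_sgn)

lemma norm_sgn_diff_le:
  fixes p q :: "'a::real_normed_vector"
  assumes "0 < c" "c \<le> norm p" "c \<le> norm q"
  shows "norm (sgn p - sgn q) \<le> 2 * norm (p - q) / c"
proof -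
  have pq: "norm p > 0" "norm q > 0" using assms by linarith+
  have "sgn p - sgn q = (p - q) /\<^sub>R norm p + (inverse (norm p) - inverse (norm q)) *\<^sub>R q"
    by (simp add: sgn_div_norm algebra_simps)
  also have "norm \<dots> \<le> norm (p - q) / norm p + \<bar>inverse (norm p) - inverse (norm q)\<bar> * norm q"
    by (rule order_trans[OF norm_triangle_ineq]) (simp add: divide_inverse mult.commute)
  also have "\<bar>inverse (norm p) - inverse (norm q)\<bar> * norm q = \<bar>norm q - norm p\<bar> / norm p"
    using pq by (simp add: inverse_eq_divide diff_frac_eq abs_mult)
  also have "\<bar>norm q - norm p\<bar> / norm p \<le> norm (p - q) / norm p"
    using pq norm_triangle_ineq3[of q p] by (intro divide_right_mono) (auto simp: norm_minus_commute)
  also have "norm (p - q) / norm p + norm (p - q) / norm p = 2 * norm (p - q) / norm p" by simp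
  also have "\<dots> \<le> 2 * norm (p - q) / c"
    using assms pq by (intro divide_left_mono) auto
  finally show ?thesis by simp
qed

text \<open>With \<open>L\<close> fixed only \<open>sgn p\<close> and 1/|p| vary, both Lipschitz
  away from 0. This allows two curvatures to be compared at a common \<open>p\<close>, at the price
  of a first-order error.\<close>

lemma curv_op_Lipschitz:
  fixes p q :: "real^'n" and c M :: real
  assumes "0 < c" "c \<le> norm p" "c \<le> norm q" and lin: "linear L"
    and M: "\<And>h. norm (L h) \<le> M * norm h" "0 \<le> M"
  shows "\<bar>curv_op p L - curv_op q L\<bar> \<le> (CARD('n) + 5) * M / c\<^sup>2 * norm (p - q)"
proof -
  have pq: "norm p > 0" "norm q > 0" using assms by linarith+
  define T where "T = (\<Sum>i\<in>UNIV. L (axis i 1) $ i)"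
  define Q where "Q = (\<lambda>p::real^'n. sgn p \<bullet> L (sgn p))"
  define d where "d = norm (p - q)"
  have [simp]: "norm (sgn p) = 1" "norm (sgn q) = 1" using pq by (auto simp: norm_sgn)
  have bil: "\<bar>y \<bullet> L z\<bar> \<le> M * (norm y * norm z)" for y z
    using Cauchy_Schwarz_ineq2[of y "L z"] mult_left_mono[OF M(1)[of z], of "norm y"]
    by (simp add: mult_ac)
  have "\<bar>T\<bar> \<le> (\<Sum>i\<in>(UNIV::'n set). M)"
    unfolding T_def
  proof (rule order_trans[OF sum_abs sum_mono])
    fix i :: 'n
    show "\<bar>L (axis i 1) $ i\<bar> \<le> M"
      using component_le_norm_cart[of "L (axis i 1)" i] M(1)[of "axis i 1"] by simp
  qed
  then have T: "\<bar>T\<bar> \<le> CARD('n) * M" by simp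
  have Qq: "\<bar>Q q\<bar> \<le> M" using bil[of "sgn q" "sgn q"] by (simp add: Q_def)
  have "Q p - Q q = (sgn p - sgn q) \<bullet> L (sgn p) + sgn q \<bullet> L (sgn p - sgn q)"
    by (simp add: Q_def linear_diff[OF lin] inner_diff_left inner_diff_right)
  then have "\<bar>Q p - Q q\<bar> \<le> 2 * (M * norm (sgn p - sgn q))"
    using bil[of "sgn p - sgn q" "sgn p"] bil[of "sgn q" "sgn p - sgn q"] by simp
  also have "\<dots> \<le> 2 * (M * (2 * d / c))"
    unfolding d_def by (intro mult_left_mono norm_sgn_diff_le assms) auto
  finally have QQ: "\<bar>Q p - Q q\<bar> \<le> 4 * M * d / c" by simp
  have inv: "\<bar>1 / norm p - 1 / norm q\<bar> \<le> d / c\<^sup>2"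
  proof -
    have "\<bar>1 / norm p - 1 / norm q\<bar> = \<bar>norm q - norm p\<bar> / (norm p * norm q)"
      using pq by (simp add: diff_frac_eq abs_mult)
    also have "\<dots> \<le> d / c\<^sup>2"
      unfolding power2_eq_square d_def norm_minus_commute[of p]
      using assms pq by (intro frac_le norm_triangle_ineq3 mult_mono) auto
    finally show ?thesis .
  qed
  \<comment> \<open>The variation of 1/|p| contributes n + 1 to the constant, that of the quadratic
    form contributes 4.\<close>
  have "curv_op p L - curv_op q L =
      (T - Q q) * (1 / norm p - 1 / norm q) - (Q p - Q q) * (1 / norm p)"
    by (simp add: curv_op_def T_def Q_def algebra_simps diff_divide_distrib)
  also have "\<bar>\<dots>\<bar> \<le> \<bar>T - Q q\<bar> * \<bar>1 / norm p - 1 / norm q\<bar> + \<bar>Q p - Q q\<bar> * (1 / norm p)"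
    by (rule order_trans[OF abs_triangle_ineq4]) (simp add: abs_mult)
  also have "\<dots> \<le> (CARD('n) * M + M) * (d / c\<^sup>2) + (4 * M * d / c) * (1 / c)"
  proof (intro add_mono mult_mono inv QQ)
    show "\<bar>T - Q q\<bar> \<le> CARD('n) * M + M" using T Qq by linarith
    show "1 / norm p \<le> 1 / c" using assms pq by (intro divide_left_mono mult_pos_pos) auto
  qed (use assms in \<open>auto simp: d_def\<close>)
  also have "\<dots> = (CARD('n) + 5) * M / c\<^sup>2 * d"
    using \<open>0 < c\<close> by (simp add: field_simps power2_eq_square)
  finally show ?thesis by (simp add: d_def)
qed

text \<open>Were \<open>k \<bullet> H k\<close> negative, the slope along \<open>k\<close> would be
  negative just after \<open>x\<close>, and the mean value theorem would give a value below the
  minimum.\<close>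

lemma second_derivative_nonneg_at_minimum:
  fixes g :: "'a::euclidean_space \<Rightarrow> real"
  assumes "open S" "x \<in> S" and der: "\<And>z. z \<in> S \<Longrightarrow> (g has_derivative (\<lambda>h. G z \<bullet> h)) (at z)"
    and H: "(G has_derivative H) (at x)" and min: "\<And>z. z \<in> S \<Longrightarrow> g x \<le> g z"
  shows "G x = 0" "0 \<le> k \<bullet> H k"
proof -
  have "(\<lambda>h. G x \<bullet> h) = (\<lambda>h. 0)"
    using differential_zero_maxmin[OF assms(2,1) der[OF assms(2)]] min by blast
  then have "G x \<bullet> G x = 0" by (rule fun_cong)
  then show G0: "G x = 0" by simp
  have line: "((\<lambda>s. x + s *\<^sub>R k) has_derivative (\<lambda>s. s *\<^sub>R k)) (at t)" for t
    by (auto intro!: derivative_eq_intros)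
  show "0 \<le> k \<bullet> H k"
  proof (rule ccontr)
    assume neg: "\<not> 0 \<le> k \<bullet> H k"
    have H0: "(G has_derivative H) (at (x + 0 *\<^sub>R k))" using H by simp
    have lin: "linear H" using H by (rule has_derivative_linear)
    have "((\<lambda>s. G (x + s *\<^sub>R k)) has_derivative (\<lambda>s. H (s *\<^sub>R k))) (at 0)"
      using has_derivative_compose[OF line[of 0] H0] .
    then have "((\<lambda>s. G (x + s *\<^sub>R k) \<bullet> k) has_derivative (\<lambda>s. H (s *\<^sub>R k) \<bullet> k)) (at 0)"
      by (rule has_derivative_inner_left)
    moreover have "(\<lambda>s. H (s *\<^sub>R k) \<bullet> k) = (*) (k \<bullet> H k)"
      by (auto simp: linear_cmul[OF lin] inner_commute)
    ultimately have "DERIV (\<lambda>s. G (x + s *\<^sub>R k) \<bullet> k) 0 :> k \<bullet> H k"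
      by (simp only: has_field_derivative_def)
    from DERIV_neg_dec_right[OF this] neg obtain d where d: "d > 0"
      and dec: "\<forall>t>0. t < d \<longrightarrow> G (x + (0 + t) *\<^sub>R k) \<bullet> k < G (x + 0 *\<^sub>R k) \<bullet> k"
      by (auto simp only: not_le)
    obtain e where e: "e > 0" "ball x e \<subseteq> S" using assms(1,2) open_contains_ball by blast
    define t where "t = min (d/2) (e / (2 * (norm k + 1)))"
    have nk: "norm k + 1 > 0" by (simp add: add_nonneg_pos)
    have t: "0 < t" "t < d" using d e(1) nk by (auto simp: t_def)
    have "t \<le> e / (2 * (norm k + 1))" by (simp add: t_def)
    then have "t * (norm k + 1) \<le> e / 2"
      using nk by (simp add: field_simps)
    then have te: "t * norm k < e" using t e(1) by (simp add: algebra_simps)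
    have inS: "x + s *\<^sub>R k \<in> S" if "0 \<le> s" "s \<le> t" for s
      using e(2) te mult_right_mono[OF that(2), of "norm k"] that by (auto simp: dist_norm)
    have "DERIV (\<lambda>s. g (x + s *\<^sub>R k)) s :> G (x + s *\<^sub>R k) \<bullet> k" if "0 \<le> s" "s \<le> t" for s
    proof -
      have "(\<lambda>t. G (x + s *\<^sub>R k) \<bullet> (t *\<^sub>R k)) = (*) (G (x + s *\<^sub>R k) \<bullet> k)" by auto
      then show ?thesis
        using has_derivative_compose[OF line[of s] der[OF inS[OF that]]]
        by (simp only: has_field_derivative_def)
    qed
    from MVT2[OF t(1) this] obtain s where s: "0 < s" "s < t"
      "g (x + t *\<^sub>R k) - g (x + 0 *\<^sub>R k) = (t - 0) * (G (x + s *\<^sub>R k) \<bullet> k)" by blast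
    have "t * (G (x + s *\<^sub>R k) \<bullet> k) < 0" using dec G0 s t by (simp add: mult_pos_neg)
    then show False using s(3) min[OF inS[of t]] t by simp
  qed
qed

subsection \<open>The Hopf lemma\<close>

text \<open>Hopf's argument: at an interior minimum of \<open>v - u - \<epsilon> (exp (-\<mu> |x - c|\<^sup>2) - const)\<close> the two
  curvatures can be compared, and the term of order \<open>\<mu>\<^sup>2\<close>, which only sees the components of \<open>x - c\<close>
  along the fields \<open>X i\<close>, contradicts the curvature inequality.\<close>

lemma perp_basis_tangent_field:
  fixes U :: "(real^'n) set"
  assumes "open U" "Ck_on 1 F U" "Ck_on 2 u U" "Ck_on 2 v U"
    and nz: "\<And>x. x \<in> U \<Longrightarrow> grad u x + F x \<noteq> 0" "\<And>x. x \<in> U \<Longrightarrow> grad v x + F x \<noteq> 0"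
    and curv: "\<And>x. x \<in> U \<Longrightarrow> mean_curv F v x \<le> mean_curv F u x"
    and uv: "\<And>x. x \<in> U \<Longrightarrow> u x \<le> v x"
    and w: "w \<in> {u, v}" and basis: "smooth_orthonormal_perp_basis U (normal_field F w) X"
    and i: "i \<in> {1..CARD('n) - 1}"
  shows "tangent_field {x \<in> U. v x = u x} (X i)"
  unfolding tangent_field_def
proof (intro ballI allI impI, rule ccontr)
  let ?S = "{x \<in> U. v x = u x}" and ?I = "{1..CARD('n) - 1}"
  fix y c0
  assume yS: "y \<in> ?S" and empty: "ball c0 (dist c0 y) \<inter> ?S = {}" and nz0: "X i y \<bullet> (c0 - y) \<noteq> 0"
  have yU: "y \<in> U" using yS by simp
  \<comment> \<open>Halving the radius makes the closed ball around \<open>c\<close> touch the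
    original sphere only at \<open>y\<close>, so within it \<open>v = u\<close> at no other point of
    \<open>U\<close>.\<close>
  define c where "c = y + (1/2) *\<^sub>R (c0 - y)"
  have inside: "v z > u z" if "z \<in> U" "z \<noteq> y" "dist z c \<le> dist y c" for z
  proof -
    define d \<nu> where "d = z - y" and "\<nu> = c0 - y"
    have "z - c = d - (1/2) *\<^sub>R \<nu>" "y - c = - ((1/2) *\<^sub>R \<nu>)" by (simp_all add: c_def d_def \<nu>_def)
    then have "norm (d - (1/2) *\<^sub>R \<nu>) \<le> norm ((1/2) *\<^sub>R \<nu>)"
      using that(3) by (simp only: dist_norm norm_minus_cancel)
    then have "(norm (d - (1/2) *\<^sub>R \<nu>))\<^sup>2 \<le> (norm ((1/2) *\<^sub>R \<nu>))\<^sup>2" by (intro power_mono) auto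
    then have "d \<bullet> d \<le> d \<bullet> \<nu>"
      unfolding power2_norm_eq_inner by (simp add: inner_diff_left inner_diff_right inner_commute)
    moreover have "d \<bullet> d > 0" using that(2) by (simp add: d_def)
    moreover have "(norm (d - \<nu>))\<^sup>2 = d \<bullet> d - 2 * (d \<bullet> \<nu>) + (norm \<nu>)\<^sup>2"
      unfolding power2_norm_eq_inner by (simp add: inner_diff_left inner_diff_right inner_commute)
    ultimately have "(norm (d - \<nu>))\<^sup>2 < (norm \<nu>)\<^sup>2" by linarith
    then have "norm (d - \<nu>) < norm \<nu>" by (rule power2_less_imp_less) simp
    then have "z \<in> ball c0 (dist c0 y)" by (simp add: d_def \<nu>_def dist_norm norm_minus_commute)
    then have "z \<notin> ?S" using empty by blast
    then show ?thesis using uv[OF that(1)] that(1) by auto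
  qed

  \<comment> \<open>Regularity of the gradient fields and of the basis\<close>
  define \<alpha> \<beta> where "\<alpha> = (\<lambda>x. grad u x + F x)" and "\<beta> = (\<lambda>x. grad v x + F x)"
  define p where "p = (\<lambda>x. grad w x + F x)"
  have p: "p = \<alpha> \<or> p = \<beta>" using w by (auto simp: p_def \<alpha>_def \<beta>_def)
  have C2: "Ck_on (Suc (Suc 0)) u U" "Ck_on (Suc (Suc 0)) v U"
    using assms(3,4) by (simp_all add: numeral_2_eq_2)
  have Ck: "Ck_on 1 \<alpha> U" "Ck_on 1 \<beta> U"
    unfolding \<alpha>_def \<beta>_def
    using Ck_on_add[OF assms(1) Ck_on_grad[OF assms(1) C2(1)]]
      Ck_on_add[OF assms(1) Ck_on_grad[OF assms(1) C2(2)]] assms(2)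
    by (simp_all only: One_nat_def)
  define A B where "A = (\<lambda>x. frechet_derivative \<alpha> (at x))" and "B = (\<lambda>x. frechet_derivative \<beta> (at x))"
  have dA: "(\<alpha> has_derivative A x) (at x)" and dB: "(\<beta> has_derivative B x) (at x)" if "x \<in> U" for x
    using Ck_on_Suc_has_derivative[of 0 \<alpha> U x] Ck_on_Suc_has_derivative[of 0 \<beta> U x] Ck that
    by (simp_all add: A_def B_def)
  have du: "(u has_derivative (\<lambda>h. grad u x \<bullet> h)) (at x)" and
    dv: "(v has_derivative (\<lambda>h. grad v x \<bullet> h)) (at x)" if "x \<in> U" for x
    using C2 that by (auto intro!: has_derivative_grad)
  have on: "X j x \<bullet> X k x = (if j = k then 1 else 0)" if "x \<in> U" "j \<in> ?I" "k \<in> ?I" for x j k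
    using basis that unfolding smooth_orthonormal_perp_basis_def by blast
  have sp: "span ((\<lambda>j. X j x) ` ?I) = {y. orthogonal (sgn (p x)) y}" if "x \<in> U" for x
    using basis that unfolding smooth_orthonormal_perp_basis_def normal_field_def
    by (simp add: p_def sgn_div_norm)
  have Xc: "continuous_on U (X j)" if "j \<in> ?I" for j
    using basis that unfolding smooth_orthonormal_perp_basis_def smooth_on_def
    by (blast intro: Ck_on_continuous_on)

  \<comment> \<open>The squared length of the component of \<open>x - c\<close> along the
    \<open>X j\<close>, which will multiply the leading term. It is positive at \<open>y\<close>
    because \<open>X i\<close> is assumed not to be tangent there.\<close>
  define f where "f = (\<lambda>x. \<Sum>j\<in>?I. (X j x \<bullet> (x - c))\<^sup>2)"
  have fc: "continuous_on U f" unfolding f_def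
    by (intro continuous_intros Xc)
  have fy: "f y > 0"
  proof -
    have "X i y \<bullet> (y - c) \<noteq> 0" using nz0 by (simp add: c_def)
    then have "0 < (X i y \<bullet> (y - c))\<^sup>2" by simp
    also have "\<dots> \<le> f y" unfolding f_def by (intro member_le_sum i) auto
    finally show ?thesis .
  qed
  define \<theta> where "\<theta> = f y / 2"
  have \<theta>: "\<theta> > 0" using fy by (simp add: \<theta>_def)
  have "\<exists>\<rho>>0. cball y \<rho> \<subseteq> U \<and> (\<forall>x\<in>cball y \<rho>. \<theta> \<le> f x)"
  proof -
    have "open (U \<inter> f -` {\<theta><..})" by (rule continuous_open_preimage[OF fc assms(1) open_greaterThan])
    moreover have "y \<in> U \<inter> f -` {\<theta><..}" using yU fy by (simp add: \<theta>_def)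
    ultimately obtain \<rho> where "\<rho> > 0" and \<rho>: "cball y \<rho> \<subseteq> U \<inter> f -` {\<theta><..}"
      using open_contains_cball by blast
    have "\<theta> \<le> f x" if "x \<in> cball y \<rho>" for x using subsetD[OF \<rho> that] by simp
    then show ?thesis using \<open>\<rho> > 0\<close> \<rho> by blast
  qed
  then obtain \<rho> where \<rho>: "\<rho> > 0" "cball y \<rho> \<subseteq> U" and f\<theta>: "\<And>x. x \<in> cball y \<rho> \<Longrightarrow> \<theta> \<le> f x" by blast

  \<comment> \<open>Uniform bounds near the contact point\<close>
  let ?K = "cball y \<rho>"
  have KU: "x \<in> U" if "x \<in> ?K" for x using that \<rho>(2) by blast
  have bounds: "\<exists>a>0. \<exists>P. \<forall>x\<in>?K. a \<le> norm (g x) \<and> norm (g x) \<le> P"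
    if "continuous_on U g" "\<And>x. x \<in> U \<Longrightarrow> g x \<noteq> 0" for g :: "real^'n \<Rightarrow> real^'n"
  proof -
    have cn: "continuous_on ?K (\<lambda>x. norm (g x))"
      using continuous_on_subset[OF that(1) \<rho>(2)] by (rule continuous_on_norm)
    have ne: "?K \<noteq> {}" using \<rho>(1) by auto
    obtain x1 where "x1 \<in> ?K" "\<And>x. x \<in> ?K \<Longrightarrow> norm (g x1) \<le> norm (g x)"
      using continuous_attains_inf[OF compact_cball ne cn] by blast
    moreover obtain x2 where "\<And>x. x \<in> ?K \<Longrightarrow> norm (g x) \<le> norm (g x2)"
      using continuous_attains_sup[OF compact_cball ne cn] by blast
    ultimately show ?thesis
      using that(2)[OF KU, of x1]
      by (intro exI[of _ "norm (g x1)"] conjI exI[of _ "norm (g x2)"]) auto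
  qed
  have ne: "\<alpha> x \<noteq> 0" "\<beta> x \<noteq> 0" if "x \<in> U" for x using nz[OF that] by (simp_all add: \<alpha>_def \<beta>_def)
  obtain a1 P1 where 1: "a1 > 0" "\<And>x. x \<in> ?K \<Longrightarrow> a1 \<le> norm (\<alpha> x) \<and> norm (\<alpha> x) \<le> P1"
    using bounds[OF Ck_on_continuous_on[OF Ck(1)] ne(1)] by blast
  obtain a2 P2 where 2: "a2 > 0" "\<And>x. x \<in> ?K \<Longrightarrow> a2 \<le> norm (\<beta> x) \<and> norm (\<beta> x) \<le> P2"
    using bounds[OF Ck_on_continuous_on[OF Ck(2)] ne(2)] by blast
  define a P where "a = min a1 a2" and "P = max P1 P2"
  have a: "a > 0" using 1 2 by (simp add: a_def)
  have a\<alpha>: "a \<le> norm (\<alpha> x)" "a \<le> norm (\<beta> x)" and pP: "norm (p x) \<le> P" if "x \<in> ?K" for x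
    using 1(2)[OF that] 2(2)[OF that] p by (auto simp: a_def P_def)
  obtain M1 where M1: "0 \<le> M1" "\<And>x h. x \<in> ?K \<Longrightarrow> norm (A x h) \<le> M1 * norm h"
    using C1_derivative_bounded[OF Ck(1) compact_cball \<rho>(2)] unfolding A_def by blast
  obtain M2 where M2: "0 \<le> M2" "\<And>x h. x \<in> ?K \<Longrightarrow> norm (B x h) \<le> M2 * norm h"
    using C1_derivative_bounded[OF Ck(2) compact_cball \<rho>(2)] unfolding B_def by blast
  \<comment> \<open>One constant for both derivatives, so that either \<open>A\<close> or
    \<open>B\<close> can be frozen while \<open>\<alpha>\<close> and \<open>\<beta>\<close> are
    exchanged.\<close>
  define C where "C = (CARD('n) + 5) * M1 / a\<^sup>2 + (CARD('n) + 5) * M2 / a\<^sup>2"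
  have C0: "C \<ge> 0" using M1 M2 by (simp add: C_def)
  have CA: "\<bar>curv_op (\<alpha> x) (A x) - curv_op (\<beta> x) (A x)\<bar> \<le> C * norm (\<beta> x - \<alpha> x)"
    and CB: "\<bar>curv_op (\<alpha> x) (B x) - curv_op (\<beta> x) (B x)\<bar> \<le> C * norm (\<beta> x - \<alpha> x)"
    if x: "x \<in> ?K" for x
  proof -
    have "\<bar>curv_op (\<alpha> x) (A x) - curv_op (\<beta> x) (A x)\<bar> \<le> (CARD('n) + 5) * M1 / a\<^sup>2 * norm (\<alpha> x - \<beta> x)"
      using M1 x dA[OF KU] by (intro curv_op_Lipschitz a a\<alpha>) (auto dest: has_derivative_linear)
    also have "\<dots> \<le> C * norm (\<alpha> x - \<beta> x)" using M2 by (intro mult_right_mono) (auto simp: C_def)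
    finally show "\<bar>curv_op (\<alpha> x) (A x) - curv_op (\<beta> x) (A x)\<bar> \<le> C * norm (\<beta> x - \<alpha> x)"
      by (simp add: norm_minus_commute)
    have "\<bar>curv_op (\<alpha> x) (B x) - curv_op (\<beta> x) (B x)\<bar> \<le> (CARD('n) + 5) * M2 / a\<^sup>2 * norm (\<alpha> x - \<beta> x)"
      using M2 x dB[OF KU] by (intro curv_op_Lipschitz a a\<alpha>) (auto dest: has_derivative_linear)
    also have "\<dots> \<le> C * norm (\<alpha> x - \<beta> x)" using M1 by (intro mult_right_mono) (auto simp: C_def)
    finally show "\<bar>curv_op (\<alpha> x) (B x) - curv_op (\<beta> x) (B x)\<bar> \<le> C * norm (\<beta> x - \<alpha> x)"
      by (simp add: norm_minus_commute)
  qed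
  define r where "r = \<rho> + dist y c"
  have r: "norm (x - c) \<le> r" if "x \<in> ?K" for x
    using dist_triangle[of x c y] that by (simp add: r_def dist_norm norm_minus_commute)
  have r0: "r \<ge> 0" using \<rho>(1) by (simp add: r_def)
  have P0: "P \<ge> 0" using order_trans[OF norm_ge_zero pP[of y]] \<rho>(1) by simp
  define m where "m = real (CARD('n) - 1)"
  \<comment> \<open>This makes \<open>2 * \<mu> * \<theta>\<close> exceed
    \<open>m + C * r * P\<close> by one; \<open>m\<close> comes from the Hessian of |x - c|^2 along
    the basis, \<open>C * r * P\<close> from the first-order error.\<close>
  define \<mu> where "\<mu> = (m + C * r * P + 1) / (2 * \<theta>)"
  have \<mu>: "\<mu> > 0" "2 * \<mu> * \<theta> > m + C * r * P"
  proof -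
    have "0 \<le> m + C * r * P" using C0 r0 P0 by (simp add: m_def)
    then show "\<mu> > 0" "2 * \<mu> * \<theta> > m + C * r * P" using \<theta> by (simp_all add: \<mu>_def)
  qed
  define h where "h = (\<lambda>x. exp (- (\<mu> * ((x - c) \<bullet> (x - c)))))"
  have hpos: "h x > 0" for x by (simp add: h_def)
  have hy: "h z < h y" if "dist z c > dist y c" for z
  proof -
    have "(norm (y - c))\<^sup>2 < (norm (z - c))\<^sup>2" using that by (intro power_strict_mono) (auto simp: dist_norm)
    then show ?thesis using \<mu>(1) by (simp add: h_def power2_norm_eq_inner)
  qed
  have h1: "h z - h y \<le> 1" for z
  proof -
    have "h z \<le> 1" using \<mu>(1) by (simp add: h_def)
    then show ?thesis using hpos[of y] by simp
  qed

  \<comment> \<open>The barrier below \<open>v - u\<close> and an interior minimum\<close>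
  have cuv: "continuous_on U (\<lambda>x. v x - u x)"
    using Ck_on_continuous_on[OF assms(3)] Ck_on_continuous_on[OF assms(4)] by (intro continuous_intros)
  \<comment> \<open>The part of the small sphere in the closed ball around \<open>c\<close> is
    compact and avoids \<open>y\<close>, so \<open>v - u\<close> has a positive minimum there; if
    that part is empty, any value will do.\<close>
  have "\<exists>\<epsilon>>0. \<forall>z\<in>sphere y \<rho> \<inter> cball c (dist y c). \<epsilon> \<le> v z - u z"
  proof (cases "sphere y \<rho> \<inter> cball c (dist y c) = {}")
    case True
    then show ?thesis by (intro exI[of _ 1]) auto
  next
    case False
    have sub: "sphere y \<rho> \<inter> cball c (dist y c) \<subseteq> U" using \<rho>(2) by auto
    have "compact (sphere y \<rho> \<inter> cball c (dist y c))" by (simp add: compact_Int_closed)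
    then obtain z0 where z0: "z0 \<in> sphere y \<rho> \<inter> cball c (dist y c)"
      "\<And>z. z \<in> sphere y \<rho> \<inter> cball c (dist y c) \<Longrightarrow> v z0 - u z0 \<le> v z - u z"
      using continuous_attains_inf[OF _ False continuous_on_subset[OF cuv sub]] by blast
    have "v z0 > u z0" using z0(1) sub \<rho>(1) by (intro inside) (auto simp: dist_commute)
    then show ?thesis using z0(2) by (intro exI[of _ "v z0 - u z0"]) auto
  qed
  then obtain \<epsilon> where \<epsilon>: "\<epsilon> > 0"
    "\<And>z. z \<in> sphere y \<rho> \<Longrightarrow> dist z c \<le> dist y c \<Longrightarrow> \<epsilon> \<le> v z - u z"
    by (force simp: dist_commute)
  define g where "g = (\<lambda>x. v x - u x - \<epsilon> * (h x - h y))"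
  have gy: "g y = 0" using yS by (simp add: g_def)
  \<comment> \<open>Inside the ball around \<open>c\<close> the choice of \<open>\<epsilon>\<close>
    decides, as \<open>h z - h y \<le> 1\<close>; outside it \<open>h z\<close> is below
    \<open>h y\<close>.\<close>
  have gs: "g z \<ge> 0" if "z \<in> sphere y \<rho>" for z
  proof (cases "dist z c \<le> dist y c")
    case True
    have "\<epsilon> * (h z - h y) \<le> \<epsilon> * 1" using \<epsilon>(1) h1 by (intro mult_left_mono) auto
    then show ?thesis using \<epsilon>(2)[OF that True] by (simp add: g_def)
  next
    case False
    have "\<epsilon> * (h z - h y) \<le> 0" using \<epsilon>(1) hy[of z] False by (intro mult_nonneg_nonpos) auto
    moreover have "u z \<le> v z" using that \<rho>(2) by (intro uv) auto
    ultimately show ?thesis by (simp add: g_def)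
  qed
  have "continuous_on ?K g"
    unfolding g_def h_def by (intro continuous_intros continuous_on_subset[OF cuv \<rho>(2)])
  then obtain x0 where x0: "x0 \<in> ?K" "\<And>z. z \<in> ?K \<Longrightarrow> g x0 \<le> g z"
    using continuous_attains_inf[OF compact_cball, of y \<rho> g] \<rho>(1) by auto
  \<comment> \<open>A minimum on the sphere has value at least \<open>g y = 0\<close>; then
    \<open>y\<close> is itself an interior minimum.\<close>
  obtain x where x: "x \<in> ball y \<rho>" "\<And>z. z \<in> ball y \<rho> \<Longrightarrow> g x \<le> g z"
  proof (cases "x0 \<in> ball y \<rho>")
    case True
    then show thesis using that x0(2) by auto
  next
    case False
    then have "x0 \<in> sphere y \<rho>" using x0(1) by auto
    then have "g y \<le> g x0" using gs gy by simp
    then have "g y \<le> g z" if "z \<in> ball y \<rho>" for z using x0(2)[of z] that by auto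
    then show thesis using that[of y] \<rho>(1) by auto
  qed
  have xK: "x \<in> ?K" and xU: "x \<in> U" using x(1) KU by auto

  \<comment> \<open>Gradient and Hessian at the minimum\<close>
  define G where "G = (\<lambda>z. \<beta> z - \<alpha> z + (2 * \<epsilon> * \<mu> * h z) *\<^sub>R (z - c))"
  define H where "H = (\<lambda>k. B x k - A x k +
    (2 * \<epsilon> * \<mu> * h x) *\<^sub>R (k - (2 * \<mu> * ((x - c) \<bullet> k)) *\<^sub>R (x - c)))"
  have dh: "(h has_derivative (\<lambda>k. - 2 * \<mu> * h z * ((z - c) \<bullet> k))) (at z)" for z
    unfolding h_def
    by (rule derivative_eq_intros refl | simp)+ (simp add: fun_eq_iff inner_commute algebra_simps)
  have gG: "(g has_derivative (\<lambda>k. G z \<bullet> k)) (at z)" if "z \<in> ball y \<rho>" for z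
  proof -
    have zU: "z \<in> U" using that KU[of z] by simp
    show ?thesis unfolding g_def
      by (rule derivative_eq_intros du[OF zU] dv[OF zU] dh refl)+
         (simp add: fun_eq_iff G_def \<alpha>_def \<beta>_def inner_add_left inner_diff_left algebra_simps)
  qed
  have GH: "(G has_derivative H) (at x)"
    unfolding G_def
    by (rule derivative_eq_intros dA[OF xU] dB[OF xU] dh refl)+
       (simp add: fun_eq_iff H_def algebra_simps)
  have G0: "G x = 0" and Hpos: "0 \<le> k \<bullet> H k" for k
    using second_derivative_nonneg_at_minimum[OF open_ball x(1) gG GH x(2)] by auto
  \<comment> \<open>By \<open>G x = 0\<close> the difference of the gradients carries the same
    factor \<open>2 * \<epsilon> * \<mu> * h x\<close> as the Hessian of the barrier, but not the
    further \<open>\<mu>\<close> of its leading term.\<close>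
  have diff: "norm (\<beta> x - \<alpha> x) \<le> 2 * \<epsilon> * \<mu> * h x * r"
  proof -
    have "\<beta> x - \<alpha> x = - ((2 * \<epsilon> * \<mu> * h x) *\<^sub>R (x - c))"
      using G0 by (simp add: G_def eq_neg_iff_add_eq_0)
    then have "norm (\<beta> x - \<alpha> x) = 2 * \<epsilon> * \<mu> * h x * norm (x - c)"
      using \<epsilon>(1) \<mu>(1) hpos[of x] by (simp add: abs_mult)
    also have "\<dots> \<le> 2 * \<epsilon> * \<mu> * h x * r"
      using \<epsilon>(1) \<mu>(1) hpos[of x] r[OF xK] by (intro mult_left_mono) auto
    finally show ?thesis .
  qed

  define s where "s = 2 * \<epsilon> * \<mu> * h x"
  have s: "s > 0" using \<epsilon>(1) \<mu>(1) hpos[of x] by (simp add: s_def)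
  define Q where "Q = (\<Sum>j\<in>?I. X j x \<bullet> (B x (X j x) - A x (X j x)))"
  have "0 \<le> (\<Sum>j\<in>?I. X j x \<bullet> H (X j x))" by (intro sum_nonneg Hpos)
  also have "\<dots> = Q + (\<Sum>j\<in>?I. s * (1 - 2 * \<mu> * (X j x \<bullet> (x - c))\<^sup>2))"
    unfolding Q_def sum.distrib[symmetric] H_def s_def
    using on[OF xU]
    by (intro sum.cong)
       (auto simp: inner_add_right inner_diff_right inner_commute power2_eq_square algebra_simps)
  also have "\<dots> = Q + s * (m - 2 * \<mu> * f x)"
    by (simp add: f_def m_def sum_subtractf sum_distrib_left algebra_simps)
  finally have Q1: "s * (2 * \<mu> * f x - m) \<le> Q" by (simp add: algebra_simps)

  \<comment> \<open>Comparison of the curvatures at the minimum\<close>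
  have px: "p x \<noteq> 0" using p nz[OF xU] by (auto simp: \<alpha>_def \<beta>_def)
  have linAB: "linear (A x)" "linear (B x)" using dA dB xU has_derivative_linear by blast+
  have "curv_op (p x) (B x) - curv_op (p x) (A x) = curv_op (p x) (\<lambda>h. B x h - A x h)"
    by (simp add: curv_op_diff)
  also have "\<dots> = Q / norm (p x)"
    unfolding Q_def using on[OF xU] sp[OF xU] px linAB
    by (intro curv_op_orthonormal linear_compose_sub) auto
  finally have Qp: "Q / norm (p x) = curv_op (p x) (B x) - curv_op (p x) (A x)" by simp
  have "mean_curv F u x = curv_op (\<alpha> x) (A x)" "mean_curv F v x = curv_op (\<beta> x) (B x)"
    using mean_curv_eq_curv_op[of u F "A x" x] mean_curv_eq_curv_op[of v F "B x" x] dA[OF xU] dB[OF xU] nz[OF xU]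
    by (simp_all add: \<alpha>_def \<beta>_def)
  then have le: "curv_op (\<beta> x) (B x) \<le> curv_op (\<alpha> x) (A x)" using curv[OF xU] by simp
  \<comment> \<open>The curvature inequality has different gradients on its two sides. To reach the
    common \<open>p\<close>, that of \<open>v\<close> is exchanged if \<open>p = \<alpha>\<close>,
    and that of \<open>u\<close> if \<open>p = \<beta>\<close>.\<close>
  have "Q / norm (p x) \<le> C * norm (\<beta> x - \<alpha> x)"
    using p
  proof
    assume "p = \<alpha>"
    then show ?thesis using CB[OF xK] le unfolding Qp by simp
  next
    assume "p = \<beta>"
    then show ?thesis using CA[OF xK] le unfolding Qp by simp
  qed
  also have "\<dots> \<le> C * (s * r)" using diff C0 by (intro mult_left_mono) (auto simp: s_def)
  finally have "Q \<le> C * (s * r) * norm (p x)" using px by (simp add: pos_divide_le_eq)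
  also have "\<dots> \<le> C * (s * r) * P" using pP[OF xK] C0 s r0 by (intro mult_left_mono) auto
  also have "\<dots> = s * (C * r * P)" by simp
  finally have "s * (2 * \<mu> * f x - m) \<le> s * (C * r * P)" using Q1 by simp
  \<comment> \<open>The factor \<open>s\<close> drops out and with it \<open>\<epsilon>\<close>,
    which is why \<open>\<mu>\<close> could be fixed before \<open>\<epsilon>\<close>.\<close>
  then have "2 * \<mu> * f x \<le> m + C * r * P" using s by (simp add: mult_le_cancel_left_pos)
  moreover have "2 * \<mu> * \<theta> \<le> 2 * \<mu> * f x" using f\<theta>[OF xK] \<mu>(1) by simp
  ultimately show False using \<mu>(2) by simp
qed

subsection \<open>The strong maximum principle\<close>

text \<open>Tangency is linear at each point, so sums and multiples by functions preserve it; only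
  brackets require the second-order argument.\<close>

lemma lie_module_tangent_field:
  assumes "open U" "closedin (top_of_set U) S"
    and gen: "\<And>X. X \<in> \<X> \<Longrightarrow> smooth_on X U" "\<And>X. X \<in> \<X> \<Longrightarrow> tangent_field S X"
    and Z: "Z \<in> lie_module U \<X>"
  shows "tangent_field S Z"
  using Z
proof induction
  case (bracket X Y)
  then have "smooth_on X U" "smooth_on Y U"
    using smooth_on_lie_module[OF assms(1) gen(1)] by blast+
  then show ?case
    using bracket.IH by (intro tangent_field_lie_bracket[OF assms(1,2)]) (simp_all add: smooth_on_def)
qed (use gen(2) in \<open>auto simp: tangent_field_def inner_add_left\<close>)

text \<open>If \<open>y\<close> is a point of \<open>S\<close> nearest to \<open>z\<close>, then
  \<open>z - y\<close> is orthogonal to all \<open>Z y\<close>, hence to the whole space, so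
  \<open>z = y\<close>. Thus \<open>S\<close> is open as well as relatively closed, and
  connectedness applies.\<close>

lemma full_rank_tangent_imp_eq:
  fixes U :: "'a::euclidean_space set"
  assumes "open U" "connected U" "closedin (top_of_set U) S" "S \<noteq> {}"
    and tan: "\<And>Z. Z \<in> \<Z> \<Longrightarrow> tangent_field S Z"
    and full: "\<And>q. q \<in> S \<Longrightarrow> span {Z q |Z. Z \<in> \<Z>} = UNIV"
  shows "S = U"
proof -
  have SU: "S \<subseteq> U" using assms(3) closedin_imp_subset by blast
  have "open S"
    unfolding open_contains_ball
  proof
    fix x assume x: "x \<in> S"
    then obtain R where R: "R > 0" "cball x R \<subseteq> U" using SU assms(1) open_contains_cball by blast
    have "z \<in> S" if "z \<in> ball x (R/2)" for z
    proof -
      have "dist z x < R/2" using that by (simp add: dist_commute)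
      then obtain y where y: "y \<in> S" "ball z (dist z y) \<inter> S = {}"
        using nearest_point_empty_ball[OF closedin_Int_cball_closed[OF assms(3) R(2)] x] by blast
      have "orthogonal (z - y) (z - y)"
      proof (rule orthogonal_to_span)
        show "z - y \<in> span {Z y |Z. Z \<in> \<Z>}" using full[OF y(1)] by simp
      next
        fix k assume "k \<in> {Z y |Z. Z \<in> \<Z>}"
        then show "orthogonal (z - y) k"
          using tan y unfolding tangent_field_def orthogonal_def by (auto simp: inner_commute)
      qed
      then show ?thesis using y(1) by (simp add: orthogonal_def)
    qed
    then show "\<exists>e>0. ball x e \<subseteq> S" using R(1) by (intro exI[of _ "R/2"]) auto
  qed
  then have "openin (top_of_set U) S" using SU open_subset by blast
  then show ?thesis using assms(2,3,4) unfolding connected_clopen by blast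
qed

theorem theoremF:
  fixes U :: "(real^'n) set"
    and F :: "real^'n \<Rightarrow> real^'n"
    and u v :: "real^'n \<Rightarrow> real"
    and p0 :: "real^'n"
  assumes "CARD('n) \<ge> 3"
    and "open U" and "connected U"
    and "Ck_on 1 F U" and "Ck_on 2 u U" and "Ck_on 2 v U"
    and "\<forall>x\<in>U. grad u x + F x \<noteq> 0"
    and "\<forall>x\<in>U. grad v x + F x \<noteq> 0"
    and "\<forall>x\<in>U. mean_curv F v x \<le> mean_curv F u x"
    and "\<forall>x\<in>U. v x \<ge> u x"
    and "p0 \<in> U" and "v p0 = u p0"
    and "\<exists>w\<in>{u, v}. \<exists>X :: nat \<Rightarrow> real^'n \<Rightarrow> real^'n.
           smooth_orthonormal_perp_basis U (normal_field F w) X \<and>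
           (\<forall>q\<in>U. lie_rank U (X ` {1..CARD('n) - 1}) q = CARD('n))"
  shows "\<forall>x\<in>U. v x = u x"
proof -
  obtain w X where w: "w \<in> {u, v}" and X: "smooth_orthonormal_perp_basis U (normal_field F w) X"
    and rank: "\<And>q. q \<in> U \<Longrightarrow> lie_rank U (X ` {1..CARD('n) - 1}) q = CARD('n)"
    using assms(13) by blast
  let ?\<X> = "X ` {1..CARD('n) - 1}" and ?S = "{x \<in> U. v x = u x}"
  have "continuous_on U (\<lambda>x. v x - u x)"
    using Ck_on_continuous_on[OF assms(5)] Ck_on_continuous_on[OF assms(6)] by (intro continuous_intros)
  from continuous_closedin_preimage_constant[OF this, of 0]
  have cl: "closedin (top_of_set U) ?S" by simp
  have "tangent_field ?S Z" if "Z \<in> lie_module U ?\<X>" for Z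
  proof (rule lie_module_tangent_field[OF assms(2) cl _ _ that])
    show "smooth_on Y U" if "Y \<in> ?\<X>" for Y
      using X that unfolding smooth_orthonormal_perp_basis_def by blast
    show "tangent_field ?S Y" if "Y \<in> ?\<X>" for Y
      using that perp_basis_tangent_field[OF assms(2,4-6) _ _ _ _ w X] assms(7-10) by blast
  qed
  moreover have "span {Z q |Z. Z \<in> lie_module U ?\<X>} = UNIV" if "q \<in> U" for q
    using rank[OF that] dim_eq_full[of "{Z q |Z. Z \<in> lie_module U ?\<X>}"]
    by (simp add: lie_rank_def)
  ultimately have "?S = U"
    using assms(11,12)
    by (intro full_rank_tangent_imp_eq[OF assms(2,3) cl, where \<Z> = "lie_module U ?\<X>"]) auto
  then show ?thesis by blast
qed

end
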